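(* For any Tychonoff space $X$, the following assertions are equivalent: (i) for every locally convex topology $\mathcal{T}$ on $C^b(X)$ satisfying $\mathcal{T}_p\subseteq\mathcal{T}\subseteq\mathcal{T}_n$, the space $C^b_{\mathcal{T}}(X)$ is strongly Gelfand--Phillips; (ii) there is a locally convex topology $\mathcal{T}$ on $C^b(X)$ such that $\mathcal{T}_p\subseteq\mathcal{T}\subseteq\mathcal{T}_n$ and the space $C^b_{\mathcal{T}}(X)$ is strongly Gelfand--Phillips; (iii) $X$ is a compact countable space of finite scattered height.
   Context: Locally convex spaces are Hausdorff and infinite-dimensional over the field $\mathbb{F}$ of real or complex numbers (so the function spaces considered are assumed infinite-dimensional). $C^b(X)$ is the vector space of all bounded continuous functions $X\to\mathbb{F}$; $C^b_{\mathcal{T}}(X)$ is $C^b(X)$ with a locally convex topology $\mathcal{T}$. $\mathcal{T}_p$ is the topology of pointwise convergence on $C^b(X)$ and $\mathcal{T}_n$ is the topology generated by the sup-norm $\|f\|_X=\sup_{x\in X}|f(x)|$. For a space $Y$ let $Y^{(0)}=Y$, $Y^{(1)}$ the set of non-isolated points of $Y$, and $Y^{(\alpha)}=\bigcap_{\beta<\alpha}(Y^{(\beta)})^{(1)}$ for ordinals $\alpha>0$; $Y$ is scattered iff $Y^{(\alpha)}=\emptyset$ for some $\alpha$, and the least such $\alpha$ is the scattered height of $Y$. A barrel is a closed absolutely convex absorbing set. A subset $B$ of a locally convex space $E$ is barrel-bounded if for every barrel $U$ there is $n\in\omega$ with $B\subseteq nU$; it is barrel-precompact if for every barrel $U$ there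 is a finite $F\subseteq E$ with $B\subseteq F+U$. For $\chi\in E'$, $\|\chi\|_B:=\sup\{|\chi(x)|:x\in B\cup\{0\}\}$. $E$ is strongly Gelfand--Phillips if there is a weak$^\ast$ null sequence $(\chi_n)_{n\in\omega}$ in $E'$ such that $\|\chi_n\|_B\not\to 0$ for every barrel-bounded, not barrel-precompact set $B\subseteq E$. *)

theory Defs
  imports "HOL-Analysis.Analysis"
begin

section \<open>Locally convex spaces over the reals or the complex numbers\<close>

text \<open>
  A locally convex space is a vector space given by its scalar multiplication
  \<open>s :: 'k \<Rightarrow> 'v \<Rightarrow> 'v\<close> on the whole type \<open>'v\<close>, together with a topology
  \<open>T\<close> with underlying set \<open>UNIV\<close>. The notions make sense for every
  \<open>'k :: real_normed_field\<close>; they are meant for \<open>real\<close> and \<open>complex\<close>.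
\<close>

definition convex_wrt :: "('k::real_normed_field \<Rightarrow> 'v::ab_group_add \<Rightarrow> 'v) \<Rightarrow> 'v set \<Rightarrow> bool" where
  "convex_wrt s V \<longleftrightarrow>
     (\<forall>x\<in>V. \<forall>y\<in>V. \<forall>t::real. 0 \<le> t \<and> t \<le> 1 \<longrightarrow> s (of_real (1 - t)) x + s (of_real t) y \<in> V)"

definition locally_convex_topology ::
    "('k::real_normed_field \<Rightarrow> 'v::ab_group_add \<Rightarrow> 'v) \<Rightarrow> 'v topology \<Rightarrow> bool" where
  "locally_convex_topology s T \<longleftrightarrow>
     vector_space s \<and> topspace T = UNIV \<and> Hausdorff_space T \<and>
     continuous_map (prod_topology T T) T (\<lambda>(x, y). x + y) \<and>
     continuous_map (prod_topology euclidean T) T (\<lambda>(c, x). s c x) \<and>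
     (\<forall>U. openin T U \<and> 0 \<in> U \<longrightarrow>
        (\<exists>V W. openin T W \<and> 0 \<in> W \<and> W \<subseteq> V \<and> V \<subseteq> U \<and> convex_wrt s V))"

definition infinite_dimensional ::
    "('k::real_normed_field \<Rightarrow> 'v::ab_group_add \<Rightarrow> 'v) \<Rightarrow> bool" where
  "infinite_dimensional s \<longleftrightarrow> \<not> (\<exists>B. finite B \<and> module.span s B = UNIV)"

definition absolutely_convex ::
    "('k::real_normed_field \<Rightarrow> 'v::ab_group_add \<Rightarrow> 'v) \<Rightarrow> 'v set \<Rightarrow> bool" where
  "absolutely_convex s U \<longleftrightarrow>
     (\<forall>x\<in>U. \<forall>y\<in>U. \<forall>a b. norm a + norm b \<le> 1 \<longrightarrow> s a x + s b y \<in> U)"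

definition absorbing ::
    "('k::real_normed_field \<Rightarrow> 'v::ab_group_add \<Rightarrow> 'v) \<Rightarrow> 'v set \<Rightarrow> bool" where
  "absorbing s U \<longleftrightarrow> (\<forall>x. \<exists>r>0. \<forall>c. norm c \<ge> r \<longrightarrow> x \<in> s c ` U)"

definition barrel ::
    "('k::real_normed_field \<Rightarrow> 'v::ab_group_add \<Rightarrow> 'v) \<Rightarrow> 'v topology \<Rightarrow> 'v set \<Rightarrow> bool" where
  "barrel s T U \<longleftrightarrow> closedin T U \<and> absolutely_convex s U \<and> absorbing s U"

definition barrel_bounded ::
    "('k::real_normed_field \<Rightarrow> 'v::ab_group_add \<Rightarrow> 'v) \<Rightarrow> 'v topology \<Rightarrow> 'v set \<Rightarrow> bool" where
  "barrel_bounded s T B \<longleftrightarrow> (\<forall>U. barrel s T U \<longrightarrow> (\<exists>n::nat. B \<subseteq> s (of_nat n) ` U))"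

definition barrel_precompact ::
    "('k::real_normed_field \<Rightarrow> 'v::ab_group_add \<Rightarrow> 'v) \<Rightarrow> 'v topology \<Rightarrow> 'v set \<Rightarrow> bool" where
  "barrel_precompact s T B \<longleftrightarrow>
     (\<forall>U. barrel s T U \<longrightarrow> (\<exists>F. finite F \<and> B \<subseteq> {x + u | x u. x \<in> F \<and> u \<in> U}))"

definition topological_dual ::
    "('k::real_normed_field \<Rightarrow> 'v::ab_group_add \<Rightarrow> 'v) \<Rightarrow> 'v topology \<Rightarrow> ('v \<Rightarrow> 'k) set" where
  "topological_dual s T = {\<phi>. Vector_Spaces.linear s (*) \<phi> \<and> continuous_map T euclidean \<phi>}"

text \<open>The supremum is taken in \<open>ereal\<close> so that it is meaningful for every set \<open>B\<close>.\<close>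

definition functional_norm_on :: "'v::zero set \<Rightarrow> ('v \<Rightarrow> 'k::real_normed_field) \<Rightarrow> ereal" where
  "functional_norm_on B \<phi> = (SUP x\<in>B \<union> {0}. ereal (norm (\<phi> x)))"

definition weak_star_null ::
    "('k::real_normed_field \<Rightarrow> 'v::ab_group_add \<Rightarrow> 'v) \<Rightarrow> 'v topology \<Rightarrow> (nat \<Rightarrow> 'v \<Rightarrow> 'k) \<Rightarrow> bool" where
  "weak_star_null s T \<phi> \<longleftrightarrow>
     (\<forall>n. \<phi> n \<in> topological_dual s T) \<and> (\<forall>x. (\<lambda>n. \<phi> n x) \<longlonglongrightarrow> 0)"

definition strongly_Gelfand_Phillips ::
    "('k::real_normed_field \<Rightarrow> 'v::ab_group_add \<Rightarrow> 'v) \<Rightarrow> 'v topology \<Rightarrow> bool" where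
  "strongly_Gelfand_Phillips s T \<longleftrightarrow>
     (\<exists>\<phi>. weak_star_null s T \<phi> \<and>
        (\<forall>B. barrel_bounded s T B \<and> \<not> barrel_precompact s T B \<longrightarrow>
           \<not> ((\<lambda>n. functional_norm_on B (\<phi> n)) \<longlonglongrightarrow> 0)))"

section \<open>Spaces of bounded continuous functions\<close>

text \<open>
  The library provides only the real scalar multiplication on \<open>'a \<Rightarrow>\<^sub>C 'k\<close>.
\<close>

definition bcont_scale ::
    "'k::real_normed_field \<Rightarrow> ('a::topological_space \<Rightarrow>\<^sub>C 'k) \<Rightarrow> ('a \<Rightarrow>\<^sub>C 'k)" where
  "bcont_scale c f = Bcontfun (\<lambda>x. c * apply_bcontfun f x)"

lemma apply_bcont_scale: "apply_bcontfun (bcont_scale c f) x = c * apply_bcontfun f x"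
proof -
  have "bounded ((\<lambda>y. c * y) ` range (apply_bcontfun f))"
    by (intro bounded_linear_image bounded_linear_mult_right) simp
  then have "(\<lambda>x. c * apply_bcontfun f x) \<in> bcontfun"
    by (auto simp: bcontfun_def image_image intro!: continuous_intros)
  then show ?thesis
    by (simp add: bcont_scale_def Bcontfun_inverse)
qed

lemma vector_space_bcont_scale:
  "vector_space (bcont_scale :: 'k::real_normed_field \<Rightarrow> ('a::topological_space \<Rightarrow>\<^sub>C 'k) \<Rightarrow> _)"
  by unfold_locales (auto intro!: bcontfun_eqI simp: apply_bcont_scale plus_bcontfun.rep_eq algebra_simps)

definition pointwise_topology ::
    "('a::topological_space \<Rightarrow>\<^sub>C 'k::real_normed_field) topology" where
  "pointwise_topology =
     pullback_topology UNIV apply_bcontfun (product_topology (\<lambda>_. euclidean) UNIV)"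

definition sup_norm_topology ::
    "('a::topological_space \<Rightarrow>\<^sub>C 'k::real_normed_field) topology" where
  "sup_norm_topology = euclidean"

definition intermediate_lc_topologies ::
    "('a::topological_space \<Rightarrow>\<^sub>C 'k::real_normed_field) topology set" where
  "intermediate_lc_topologies =
     {T. locally_convex_topology bcont_scale T \<and>
         {U. openin pointwise_topology U} \<subseteq> {U. openin T U} \<and>
         {U. openin T U} \<subseteq> {U. openin sup_norm_topology U}}"

section \<open>Scattered height\<close>

text \<open>
  Ordinals are represented by the elements of a well-ordered type \<open>'o\<close>. For the least
  element the intersection is empty, which gives the whole space.
\<close>

function cb_derivative :: "'o::wellorder \<Rightarrow> 'a::topological_space set" where
  "cb_derivative \<alpha> =
     (\<Inter>\<beta>\<in>{\<beta>. \<beta> < \<alpha>}. {x \<in> cb_derivative \<beta>. \<not> x isolated_in cb_derivative \<beta>})"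
  by auto
termination
  by (relation "{(\<beta>, \<alpha>). \<beta> < \<alpha>}") (auto intro: wf)

declare cb_derivative.simps [simp del]

text \<open>
  The finite ordinals are the natural numbers, so the least \<open>\<alpha>\<close> with empty
  \<open>\<alpha>\<close>-th derivative exists and is finite iff some derivative indexed by a natural
  number is empty.
\<close>

definition finite_scattered_height :: "'a::topological_space itself \<Rightarrow> bool" where
  "finite_scattered_height _ \<longleftrightarrow> (\<exists>n::nat. (cb_derivative n :: 'a set) = {})"

end

(*
  Barrels of an intermediate topology contain a sup-norm ball (Baire), and sup-norm balls
  are barrels, so "barrel-bounded" and "barrel-precompact" mean norm bounded and totally
  bounded, independently of the topology.

  If X is compact, countable and of finite height, every point x of rank k is sent to a
  nearest point p x of the next derivative (with respect to a continuous separation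
  function). The functionals f |-> f x - f (p x) form a weak* null sequence; if they tend to
  0 uniformly on a bounded set B, then elements of B are determined up to a small error by
  their values on a finite set, so B is totally bounded.

  Conversely, a sequence witnessing the property is bounded by some M in norm, and only
  boundedly many separated elements of the unit ball can be nearly annihilated by it. If all
  derivatives of X were non-empty, one could build disjointly supported functions of
  arbitrary height on which the functionals stay below M + 1, a contradiction. Moreover the
  unit ball contains no uncountable separated set, which makes each layer of X countable,
  and a countable X without finite subcover would have an infinite clopen partition, whose
  unions have uncountably many separated indicators.
*)
theory Submission
  imports Defs
begin

section \<open>Barrels of intermediate topologies\<close>

text \<open>Only the functionals see the topology. Point evaluations are continuous already for
  pointwise convergence, so one sequence built from them serves every intermediate topology.
  Conversely, the polar of a weak* null sequence is a barrel of the given topology, hence contains a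
  norm ball, and this yields the constant M.

  Both directions measure the height. When two functions are compared, each passage from x to p x
  costs the tolerance twice, so a uniform error needs a bounded number of passages. In the other
  direction, a function of height n + 1 with functionals below M + 1 is divided by n + 1: its norm
  becomes 1 and the functionals drop to (M + 1) / (n + 1), below any prescribed threshold.

  The conclusions rest on one another: the layers exhaust the space once the height is finite, and
  clopen neighbourhoods come from countability, so compactness is obtained last.\<close>

lemma bcont_scale_of_real: "bcont_scale (of_real r) f = r *\<^sub>R f"
  by (rule bcontfun_eqI) (simp add: apply_bcont_scale scaleR_conv_of_real)

lemma norm_bcont_scale_le: "norm (bcont_scale c f) \<le> norm c * norm f"
  by (rule norm_bound) (simp add: apply_bcont_scale norm_mult mult_left_mono norm_bounded)

lemma bcont_scale_inverse:
  assumes "c \<noteq> 0"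
  shows "bcont_scale c (bcont_scale (inverse c) f) = f"
  by (rule bcontfun_eqI) (simp add: apply_bcont_scale assms)

text \<open>
  The library has completeness of \<open>'a \<Rightarrow>\<^sub>C 'b\<close> only for metric domains.
\<close>

lemma complete_UNIV_bcontfun:
  "complete (UNIV :: ('a::topological_space \<Rightarrow>\<^sub>C 'b::complete_space) set)"
  unfolding complete_def
proof (intro allI impI)
  fix f :: "nat \<Rightarrow> ('a \<Rightarrow>\<^sub>C 'b)"
  assume "(\<forall>n. f n \<in> UNIV) \<and> Cauchy f"
  then have "Cauchy f" by simp
  then obtain g where "uniform_limit UNIV f g sequentially"
    using uniformly_convergent_eq_cauchy[of "\<lambda>_. True" f]
    unfolding Cauchy_def uniform_limit_sequentially_iff
    by (metis dist_fun_lt_imp_dist_val_lt)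
  from uniform_limit_bcontfunE[OF this sequentially_bot]
  obtain l where "f \<longlonglongrightarrow> l" by metis
  then show "\<exists>l\<in>UNIV. f \<longlonglongrightarrow> l" by blast
qed

text \<open>Absorption is used along the integer factors n + 1, which makes the cover in Baire's
  theorem countable.\<close>

lemma absorbing_imp_scaleR_mem:
  fixes U :: "('a::topological_space \<Rightarrow>\<^sub>C 'k::real_normed_field) set"
  assumes "absorbing bcont_scale U" and "absolutely_convex bcont_scale U"
  shows "\<exists>n::nat. (1 / real (Suc n)) *\<^sub>R f \<in> U"
proof -
  obtain r where r: "r > 0" "\<forall>c. norm c \<ge> r \<longrightarrow> f \<in> bcont_scale c ` U"
    using assms(1) unfolding absorbing_def by blast
  obtain n :: nat where n: "real n \<ge> r"
    using real_arch_simple by blast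
  have "norm (of_real (real (Suc n)) :: 'k) \<ge> r"
    using n by (simp only: norm_of_real)
  then obtain g where g: "g \<in> U" "f = bcont_scale (of_real (real (Suc n))) g"
    using r(2) by blast
  have "(1 / real (Suc n)) *\<^sub>R f = g"
    unfolding g(2) bcont_scale_of_real by simp
  then show ?thesis using g(1) by metis
qed

text \<open>By Baire's theorem one of the closed dilates of \<open>U\<close> contains a ball; its
  centre \<open>f0\<close> is then removed by symmetry.\<close>

lemma closed_barrel_contains_cball:
  fixes U :: "('a::topological_space \<Rightarrow>\<^sub>C 'k::{real_normed_field,complete_space}) set"
  assumes "closed U" "absolutely_convex bcont_scale U" "absorbing bcont_scale U"
  obtains r where "r > 0" "cball 0 r \<subseteq> U"
proof -
  define V where "V n = {f. (1 / real (Suc n)) *\<^sub>R f \<in> U}" for n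
  have cl: "closed (V n)" for n
  proof -
    have "V n = (\<lambda>f. (1 / real (Suc n)) *\<^sub>R f) -` U" by (auto simp: V_def)
    then show ?thesis
      by (simp only:) (intro continuous_closed_vimage assms continuous_intros)
  qed
  have un: "\<Union>(range V) = UNIV"
    using absorbing_imp_scaleR_mem[OF assms(3,2)] by (auto simp: V_def)
  have "\<exists>n. interior (V n) \<noteq> {}"
  proof (rule ccontr)
    assume "\<not> ?thesis"
    then have *: "interior (V n) = {}" for n by simp
    have "Met_TC.mtopology interior_of \<Union>(range V) = {}"
    proof (rule Met_TC.metric_Baire_category_alt)
      show "Met_TC.mcomplete TYPE('a \<Rightarrow>\<^sub>C 'k)"
        unfolding mcomplete_iff_complete by (rule complete_UNIV_bcontfun)
    qed (auto simp: cl *)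
    then show False by (simp add: un)
  qed
  then obtain n f0 e where e: "e > 0" "ball f0 e \<subseteq> V n"
    by (metis ex_in_conv mem_interior)
  show thesis
  proof
    \<comment> \<open>\<open>Suc n\<close> undoes the dilation, and the factor 2 keeps the shifted
      points inside the open ball.\<close>
    show "e / (2 * real (Suc n)) > 0" using e by simp
    show "cball 0 (e / (2 * real (Suc n))) \<subseteq> U"
    proof
      fix g :: "'a \<Rightarrow>\<^sub>C 'k"
      assume "g \<in> cball 0 (e / (2 * real (Suc n)))"
      then have g: "real (Suc n) * norm g \<le> e / 2" by (simp add: field_simps)
      let ?g = "real (Suc n) *\<^sub>R g"
      have "norm ?g \<le> e / 2" using g by simp
      then have "f0 + ?g \<in> ball f0 e" "f0 - ?g \<in> ball f0 e"
        using e(1) by (auto simp: dist_norm)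
      then have "f0 + ?g \<in> V n" "f0 - ?g \<in> V n" using e(2) by blast+
      then have *: "(1 / real (Suc n)) *\<^sub>R (f0 + ?g) \<in> U" "(1 / real (Suc n)) *\<^sub>R (f0 - ?g) \<in> U"
        by (auto simp: V_def)
      \<comment> \<open>Half the difference of two points symmetric about the scaled
        \<open>f0\<close> cancels the centre; absolute convexity admits the coefficients 1/2 and
        -1/2.\<close>
      have "bcont_scale (of_real (1/2)) ((1 / real (Suc n)) *\<^sub>R (f0 + ?g))
          + bcont_scale (of_real (- (1/2))) ((1 / real (Suc n)) *\<^sub>R (f0 - ?g)) \<in> U"
        using assms(2) * unfolding absolutely_convex_def norm_of_real by simp
      also have "bcont_scale (of_real (1/2)) ((1 / real (Suc n)) *\<^sub>R (f0 + ?g))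
          + bcont_scale (of_real (- (1/2))) ((1 / real (Suc n)) *\<^sub>R (f0 - ?g)) =
          (1/2) *\<^sub>R ((1 / real (Suc n)) *\<^sub>R (f0 + ?g)) + (-(1/2)) *\<^sub>R ((1 / real (Suc n)) *\<^sub>R (f0 - ?g))"
        unfolding bcont_scale_of_real ..
      also have "\<dots> = g"
      proof -
        have "(1/2) *\<^sub>R (c *\<^sub>R (a + b)) + (-(1/2)) *\<^sub>R (c *\<^sub>R (a - b)) = c *\<^sub>R b"
          for a b :: "'a \<Rightarrow>\<^sub>C 'k" and c
        proof -
          have "(1/2) *\<^sub>R (c *\<^sub>R (a + b)) + (-(1/2)) *\<^sub>R (c *\<^sub>R (a - b)) = c *\<^sub>R ((1/2) *\<^sub>R (b + b))"
            by (simp add: algebra_simps)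
          then show ?thesis by (simp add: scaleR_half_double)
        qed
        then have "(1/2) *\<^sub>R ((1 / real (Suc n)) *\<^sub>R (f0 + ?g)) + (-(1/2)) *\<^sub>R ((1 / real (Suc n)) *\<^sub>R (f0 - ?g))
            = (1 / real (Suc n)) *\<^sub>R ?g" .
        then show ?thesis by (simp only:) simp
      qed
      finally show "g \<in> U" .
    qed
  qed
qed

section \<open>Norm balls and barrels across the intermediate topologies\<close>

lemma continuous_map_pointwise_eval:
  "continuous_map pointwise_topology euclidean (\<lambda>f. apply_bcontfun f x)"
proof -
  have "continuous_map pointwise_topology euclidean ((\<lambda>h. h x) \<circ> apply_bcontfun)"
    unfolding pointwise_topology_def
    by (rule continuous_map_pullback) (rule continuous_map_product_projection, simp)
  then show ?thesis by (simp add: o_def)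
qed

lemma topspace_pointwise_topology [simp]: "topspace pointwise_topology = UNIV"
  by (simp add: pointwise_topology_def topspace_pullback_topology)

text \<open>The ball is an intersection of conditions on single values, hence closed for the
  coarsest admissible topology and so for all of them.\<close>

lemma closedin_pointwise_cball:
  "closedin pointwise_topology (cball 0 r :: ('a::topological_space \<Rightarrow>\<^sub>C 'k::real_normed_field) set)"
proof -
  let ?C = "\<lambda>x. {f \<in> topspace (pointwise_topology :: ('a \<Rightarrow>\<^sub>C 'k) topology). apply_bcontfun f x \<in> cball (0::'k) r}"
  have "closedin pointwise_topology (?C x)" for x :: 'a
    by (rule closedin_continuous_map_preimage[OF continuous_map_pointwise_eval]) simp
  then have "closedin pointwise_topology (\<Inter>x. ?C x)" by (intro closedin_INT) blast+
  also have "(\<Inter>x. ?C x) = cball 0 r"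
    by (auto intro!: norm_bound intro: order_trans[OF norm_bounded])
  finally show ?thesis .
qed

lemma intermediate_topspace:
  "T \<in> intermediate_lc_topologies \<Longrightarrow> topspace T = UNIV"
  by (simp add: intermediate_lc_topologies_def locally_convex_topology_def)

lemma intermediate_closed:
  assumes "T \<in> intermediate_lc_topologies" "closedin T U"
  shows "closed U"
proof -
  have "openin T (- U)" using assms by (simp add: closedin_def intermediate_topspace Compl_eq_Diff_UNIV)
  then have "openin sup_norm_topology (- U)"
    using assms(1) by (auto simp: intermediate_lc_topologies_def)
  then show ?thesis by (simp add: sup_norm_topology_def closed_def)
qed

lemma intermediate_continuous:
  assumes "T \<in> intermediate_lc_topologies" "continuous_map pointwise_topology Y h"
  shows "continuous_map T Y h"
proof -
  have "openin T U" if "openin pointwise_topology U" for U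
    using assms(1) that by (auto simp: intermediate_lc_topologies_def)
  then show ?thesis
    using assms(2) unfolding continuous_map_def
    by (simp add: intermediate_topspace[OF assms(1)])
qed

lemma barrel_contains_cball:
  fixes T :: "('a::topological_space \<Rightarrow>\<^sub>C 'k::{real_normed_field,complete_space}) topology"
  assumes "T \<in> intermediate_lc_topologies" "barrel bcont_scale T U"
  obtains r where "r > 0" "cball 0 r \<subseteq> U"
proof (rule closed_barrel_contains_cball)
  show "closed U" "absolutely_convex bcont_scale U" "absorbing bcont_scale U"
    using assms(2) intermediate_closed[OF assms(1), of U] by (simp_all add: barrel_def)
qed (rule that)

lemma barrel_cball:
  fixes T :: "('a::topological_space \<Rightarrow>\<^sub>C 'k::real_normed_field) topology"
  assumes "T \<in> intermediate_lc_topologies" "r > 0"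
  shows "barrel bcont_scale T (cball 0 r)"
  unfolding barrel_def
proof (intro conjI)
  show "closedin T (cball 0 r)"
    using closedin_pointwise_cball[of r] assms(1)
    by (auto simp: closedin_def intermediate_lc_topologies_def locally_convex_topology_def)
  show "absolutely_convex bcont_scale (cball 0 r :: ('a \<Rightarrow>\<^sub>C 'k) set)"
    unfolding absolutely_convex_def
  proof (intro ballI allI impI)
    fix x y and a b :: 'k
    assume "x \<in> cball (0::'a \<Rightarrow>\<^sub>C 'k) r" "y \<in> cball (0::'a \<Rightarrow>\<^sub>C 'k) r" and ab: "norm a + norm b \<le> 1"
    then have "norm x \<le> r" "norm y \<le> r" by auto
    have "norm (bcont_scale a x + bcont_scale b y) \<le> norm a * norm x + norm b * norm y"
      by (intro norm_triangle_le add_mono norm_bcont_scale_le)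
    also have "\<dots> \<le> norm a * r + norm b * r"
      using \<open>norm x \<le> r\<close> \<open>norm y \<le> r\<close> by (intro add_mono mult_left_mono) auto
    also have "\<dots> = (norm a + norm b) * r" by (simp add: distrib_right)
    also have "\<dots> \<le> 1 * r" using ab assms(2) by (intro mult_right_mono) auto
    finally show "bcont_scale a x + bcont_scale b y \<in> cball 0 r" by simp
  qed
  show "absorbing bcont_scale (cball 0 r :: ('a \<Rightarrow>\<^sub>C 'k) set)"
    unfolding absorbing_def
  proof
    fix f :: "'a \<Rightarrow>\<^sub>C 'k"
    show "\<exists>ra>0. \<forall>c. ra \<le> norm c \<longrightarrow> f \<in> bcont_scale c ` cball 0 r"
    \<comment> \<open>The summand 1 keeps \<open>c\<close> away from 0, also when \<open>f\<close>
      is 0.\<close>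
    proof (intro exI[of _ "norm f / r + 1"] conjI allI impI)
      show "0 < norm f / r + 1" using assms(2) by (simp add: add_nonneg_pos)
      fix c :: 'k
      assume c: "norm f / r + 1 \<le> norm c"
      then have "norm c > 0" using assms(2) \<open>0 < norm f / r + 1\<close> by linarith
      have "norm f / r \<le> norm c" using c by simp
      then have "norm f \<le> norm c * r" using assms(2) by (simp add: field_simps)
      have "norm (bcont_scale (inverse c) f) \<le> norm (inverse c) * norm f"
        by (rule norm_bcont_scale_le)
      also have "\<dots> \<le> r"
        using \<open>norm c > 0\<close> \<open>norm f \<le> norm c * r\<close> by (simp add: norm_inverse pos_divide_le_eq mult.commute flip: divide_inverse)
      finally have "bcont_scale (inverse c) f \<in> cball 0 r" by simp
      moreover have "f = bcont_scale c (bcont_scale (inverse c) f)"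
        using \<open>norm c > 0\<close> by (subst bcont_scale_inverse) auto
      ultimately show "f \<in> bcont_scale c ` cball 0 r" by blast
    qed
  qed
qed

lemma barrel_bounded_iff_bounded:
  fixes T :: "('a::topological_space \<Rightarrow>\<^sub>C 'k::{real_normed_field,complete_space}) topology"
  assumes T: "T \<in> intermediate_lc_topologies"
  shows "barrel_bounded bcont_scale T B \<longleftrightarrow> bounded B"
proof
  assume "barrel_bounded bcont_scale T B"
  then obtain n :: nat where n: "B \<subseteq> bcont_scale (of_nat n) ` cball 0 1"
    using barrel_cball[OF T, of 1] unfolding barrel_bounded_def by auto
  show "bounded B"
  proof (rule boundedI)
    fix f assume "f \<in> B"
    then obtain g where g: "norm g \<le> 1" "f = bcont_scale (of_nat n) g" using n by auto
    have "norm f \<le> norm (of_nat n :: 'k) * norm g" unfolding g(2) by (rule norm_bcont_scale_le)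
    also have "\<dots> \<le> real n * 1" using g by (intro mult_mono) auto
    finally show "norm f \<le> real n" by simp
  qed
next
  assume "bounded B"
  then obtain K where K: "\<And>f. f \<in> B \<Longrightarrow> norm f \<le> K" unfolding bounded_iff by blast
  show "barrel_bounded bcont_scale T B"
    unfolding barrel_bounded_def
  proof (intro allI impI)
    fix U :: "('a \<Rightarrow>\<^sub>C 'k) set" assume "barrel bcont_scale T U"
    then obtain r where r: "r > 0" "cball 0 r \<subseteq> U" using barrel_contains_cball[OF T] by blast
    \<comment> \<open>The 1 in the maximum makes the scalar \<open>n\<close> invertible.\<close>
    obtain n :: nat where n: "max 1 (K / r) \<le> real n" using real_arch_simple by blast
    have "B \<subseteq> bcont_scale (of_nat n) ` U"
    proof
      fix f assume "f \<in> B"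
      have "norm f \<le> real n * r" using K[OF \<open>f \<in> B\<close>] n r(1) by (simp add: field_simps)
      have "norm (bcont_scale (inverse (of_nat n)) f) \<le> norm (inverse (of_nat n) :: 'k) * norm f"
        by (rule norm_bcont_scale_le)
      also have "\<dots> \<le> r"
        using n \<open>norm f \<le> real n * r\<close>
        by (simp add: norm_inverse pos_divide_le_eq mult.commute flip: divide_inverse)
      finally have "bcont_scale (inverse (of_nat n)) f \<in> U" using r(2) by auto
      moreover have "f = bcont_scale (of_nat n) (bcont_scale (inverse (of_nat n)) f)"
        using n by (subst bcont_scale_inverse) auto
      ultimately show "f \<in> bcont_scale (of_nat n) ` U" by blast
    qed
    then show "\<exists>n. B \<subseteq> bcont_scale (of_nat n) ` U" by blast
  qed
qed

lemma barrel_precompact_iff_totally_bounded: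
  fixes T :: "('a::topological_space \<Rightarrow>\<^sub>C 'k::{real_normed_field,complete_space}) topology"
  assumes T: "T \<in> intermediate_lc_topologies"
  shows "barrel_precompact bcont_scale T B \<longleftrightarrow>
    (\<forall>e>0. \<exists>F. finite F \<and> B \<subseteq> (\<Union>f\<in>F. cball f e))"
proof -
  have *: "(\<Union>f\<in>F. cball f e) = {f + u | f u. f \<in> F \<and> u \<in> cball 0 e}"
    for F :: "('a \<Rightarrow>\<^sub>C 'k) set" and e
  proof (intro set_eqI iffI)
    fix g assume "g \<in> (\<Union>f\<in>F. cball f e)"
    then obtain f where "f \<in> F" "norm (g - f) \<le> e" by (auto simp: dist_norm norm_minus_commute)
    then have "f \<in> F" "g - f \<in> cball 0 e" "g = f + (g - f)" by auto
    then show "g \<in> {f + u | f u. f \<in> F \<and> u \<in> cball 0 e}" by blast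
  qed (force simp: dist_norm)
  show ?thesis
  proof
    assume L: "barrel_precompact bcont_scale T B"
    show "\<forall>e>0. \<exists>F. finite F \<and> B \<subseteq> (\<Union>f\<in>F. cball f e)"
    proof (intro allI impI)
      fix e :: real assume "e > 0"
      then show "\<exists>F. finite F \<and> B \<subseteq> (\<Union>f\<in>F. cball f e)"
        unfolding * using L barrel_cball[OF T, of e] by (simp only: barrel_precompact_def)
    qed
  next
    assume R: "\<forall>e>0. \<exists>F. finite F \<and> B \<subseteq> (\<Union>f\<in>F. cball f e)"
    show "barrel_precompact bcont_scale T B"
      unfolding barrel_precompact_def
    proof (intro allI impI)
      fix U :: "('a \<Rightarrow>\<^sub>C 'k) set" assume "barrel bcont_scale T U"
      then obtain r where r: "r > 0" "cball 0 r \<subseteq> U" using barrel_contains_cball[OF T] by blast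
      obtain F where F: "finite F" "B \<subseteq> (\<Union>f\<in>F. cball f r)"
        using R r(1) by blast
      note F(2)[unfolded *]
      also have "{f + u | f u. f \<in> F \<and> u \<in> cball 0 r} \<subseteq> {f + u | f u. f \<in> F \<and> u \<in> U}"
        using r(2) by blast
      finally show "\<exists>F. finite F \<and> B \<subseteq> {f + u | f u. f \<in> F \<and> u \<in> U}" using F(1) by blast
    qed
  qed
qed

section \<open>The sup-norm topology as an intermediate topology\<close>

lemma locally_convex_sup_norm_topology:
  "locally_convex_topology bcont_scale
    (sup_norm_topology :: ('a::topological_space \<Rightarrow>\<^sub>C 'k::real_normed_field) topology)"
  unfolding locally_convex_topology_def
proof (intro conjI allI impI)
  show "vector_space (bcont_scale :: 'k \<Rightarrow> ('a \<Rightarrow>\<^sub>C 'k) \<Rightarrow> _)" by (rule vector_space_bcont_scale)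
  show "topspace sup_norm_topology = (UNIV :: ('a \<Rightarrow>\<^sub>C 'k) set)" by (simp add: sup_norm_topology_def)
  show "Hausdorff_space (sup_norm_topology :: ('a \<Rightarrow>\<^sub>C 'k) topology)"
    by (simp add: sup_norm_topology_def)
  have "continuous_on UNIV (\<lambda>p :: ('a \<Rightarrow>\<^sub>C 'k) \<times> ('a \<Rightarrow>\<^sub>C 'k). fst p + snd p)"
    by (intro continuous_intros)
  then show "continuous_map (prod_topology sup_norm_topology sup_norm_topology)
     (sup_norm_topology :: ('a \<Rightarrow>\<^sub>C 'k) topology) (\<lambda>(x, y). x + y)"
    by (simp add: sup_norm_topology_def case_prod_unfold flip: euclidean_product_topology)
  have "bounded_bilinear (bcont_scale :: 'k \<Rightarrow> ('a \<Rightarrow>\<^sub>C 'k) \<Rightarrow> _)"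
  proof
    show "\<exists>K. \<forall>c (f :: 'a \<Rightarrow>\<^sub>C 'k). norm (bcont_scale c f) \<le> norm c * norm f * K"
      using norm_bcont_scale_le by (intro exI[of _ 1]) auto
  qed (auto intro!: bcontfun_eqI simp: apply_bcont_scale algebra_simps)
  then interpret bounded_bilinear "bcont_scale :: 'k \<Rightarrow> ('a \<Rightarrow>\<^sub>C 'k) \<Rightarrow> _" .
  have "continuous_on UNIV (\<lambda>p :: 'k \<times> ('a \<Rightarrow>\<^sub>C 'k). bcont_scale (fst p) (snd p))"
    by (intro continuous_on continuous_intros)
  then show "continuous_map (prod_topology euclidean sup_norm_topology)
     (sup_norm_topology :: ('a \<Rightarrow>\<^sub>C 'k) topology) (\<lambda>(c, x). bcont_scale c x)"
    by (simp add: sup_norm_topology_def case_prod_unfold flip: euclidean_product_topology)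
  fix U :: "('a \<Rightarrow>\<^sub>C 'k) set"
  assume "openin sup_norm_topology U \<and> 0 \<in> U"
  then obtain e where e: "e > 0" "ball 0 e \<subseteq> U"
    unfolding sup_norm_topology_def by (metis open_contains_ball open_openin)
  have "convex_wrt bcont_scale (ball 0 e :: ('a \<Rightarrow>\<^sub>C 'k) set)"
    unfolding convex_wrt_def bcont_scale_of_real
    using convexD[OF convex_ball[of "0 :: 'a \<Rightarrow>\<^sub>C 'k" e]] by auto
  with e show "\<exists>V W. openin sup_norm_topology W \<and> 0 \<in> W \<and> W \<subseteq> V \<and> V \<subseteq> U \<and> convex_wrt bcont_scale V"
    by (intro exI[of _ "ball 0 e"]) (auto simp: sup_norm_topology_def)
qed

text \<open>This witness is what lets the universal statement over intermediate topologies imply the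
  existential one.\<close>

lemma sup_norm_topology_intermediate:
  "(sup_norm_topology :: ('a::topological_space \<Rightarrow>\<^sub>C 'k::real_normed_field) topology)
    \<in> intermediate_lc_topologies"
proof -
  have c: "continuous_on UNIV (apply_bcontfun :: ('a \<Rightarrow>\<^sub>C 'k) \<Rightarrow> 'a \<Rightarrow> 'k)"
  proof (rule continuous_on_coordinatewise_then_product)
    fix x :: 'a
    show "continuous_on UNIV (\<lambda>f :: 'a \<Rightarrow>\<^sub>C 'k. apply_bcontfun f x)"
      unfolding continuous_on_iff by (metis dist_fun_lt_imp_dist_val_lt)
  qed
  have "open U" if U: "openin pointwise_topology U" for U :: "('a \<Rightarrow>\<^sub>C 'k) set"
  proof -
    obtain V :: "('a \<Rightarrow> 'k) set"
      where V: "openin (product_topology (\<lambda>_. euclidean) UNIV) V" "U = apply_bcontfun -` V \<inter> UNIV"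
      using U unfolding pointwise_topology_def openin_pullback_topology by metis
    have "open V" using V(1) unfolding euclidean_product_topology by (rule iffD2[OF open_openin])
    then show ?thesis using c V(2) by (simp add: open_vimage)
  qed
  then show ?thesis
    unfolding intermediate_lc_topologies_def
    using locally_convex_sup_norm_topology by (simp add: Collect_mono sup_norm_topology_def)
qed

section \<open>Derivatives of finite order\<close>

lemma cb_derivative_0: "cb_derivative (0::nat) = UNIV"
  by (subst cb_derivative.simps) simp

text \<open>The intersection over all indices below \<open>Suc n\<close> splits off the index
  \<open>n\<close>; what remains is the defining intersection of the \<open>n\<close>-th
  derivative.\<close>

lemma cb_derivative_Suc:
  "cb_derivative (Suc n) = {x \<in> cb_derivative n. \<not> x isolated_in cb_derivative n}"
proof -
  let ?D = "\<lambda>\<beta>. {x \<in> cb_derivative \<beta>. \<not> x isolated_in cb_derivative \<beta>}"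
  have "{\<beta>. \<beta> < Suc n} = insert n {\<beta>. \<beta> < n}" by auto
  then have "cb_derivative (Suc n) = ?D n \<inter> (\<Inter>\<beta>\<in>{\<beta>. \<beta> < n}. ?D \<beta>)"
    by (subst cb_derivative.simps) (simp only: INT_insert)
  also have "(\<Inter>\<beta>\<in>{\<beta>. \<beta> < n}. ?D \<beta>) = cb_derivative n"
    by (rule cb_derivative.simps[symmetric])
  finally show ?thesis by blast
qed

lemma cb_derivative_Suc_subset: "cb_derivative (Suc n) \<subseteq> cb_derivative n"
  by (auto simp: cb_derivative_Suc)

text \<open>A neighbourhood that isolates a point in the \<open>n\<close>-th derivative misses the
  next derivative entirely.\<close>

lemma closed_cb_derivative: "closed (cb_derivative (n::nat) :: 'a::topological_space set)"
proof (induction n)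
  case 0
  show ?case by (simp add: cb_derivative_0)
next
  case (Suc n)
  have "open (- cb_derivative (Suc n) :: 'a set)"
  proof (rule topological_space_class.openI)
    fix x :: 'a assume x: "x \<in> - cb_derivative (Suc n)"
    show "\<exists>V. open V \<and> x \<in> V \<and> V \<subseteq> - cb_derivative (Suc n)"
    proof (cases "x \<in> cb_derivative n")
      case True
      then have iso: "x isolated_in cb_derivative n" using x by (simp add: cb_derivative_Suc)
      then obtain V where V: "open V" "V \<inter> cb_derivative n = {x}"
        unfolding isolated_in_def by blast
      have "V \<subseteq> - cb_derivative (Suc n)"
        using V(2) iso by (auto simp: cb_derivative_Suc)
      then show ?thesis using V by blast
    next
      case False
      have "open (- cb_derivative n :: 'a set)" using Suc by (simp only: open_Compl)
      with False show ?thesis using cb_derivative_Suc_subset[of n] by blast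
    qed
  qed
  then show ?case by (simp add: closed_def)
qed

lemma cb_derivative_decseq:
  assumes "m \<le> n"
  shows "cb_derivative n \<subseteq> cb_derivative (m::nat)"
  using assms cb_derivative_Suc_subset by (induction rule: dec_induct) blast+

text \<open>Because of the \<open>Suc\<close>, this is the index of the last derivative containing
  the point, its Cantor-Bendixson rank. For a point in all finite derivatives the value is
  arbitrary, so the facts below assume an empty derivative.\<close>

definition cb_rank :: "'a::topological_space \<Rightarrow> nat" where
  "cb_rank x = (LEAST n. x \<notin> cb_derivative (Suc n))"

lemma
  assumes "cb_derivative (m::nat) = ({} :: 'a::topological_space set)"
  shows cb_rank_less: "cb_rank (x::'a) < m"
    and cb_rank_mem: "x \<in> cb_derivative (cb_rank x)"
    and cb_rank_notin: "x \<notin> cb_derivative (Suc (cb_rank x))"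
proof -
  have "m \<noteq> 0" using assms by (intro notI) (simp add: cb_derivative_0)
  then obtain k where k: "m = Suc k" using not0_implies_Suc by blast
  then have *: "x \<notin> cb_derivative (Suc k)" using assms by simp
  show "x \<notin> cb_derivative (Suc (cb_rank x))"
    unfolding cb_rank_def by (rule LeastI[of "\<lambda>n. x \<notin> cb_derivative (Suc n)", OF *])
  have "cb_rank x \<le> k" unfolding cb_rank_def using * by (rule Least_le)
  then show "cb_rank x < m" using k by simp
  show "x \<in> cb_derivative (cb_rank x)"
  proof (cases "cb_rank x")
    case 0
    then show ?thesis by (simp add: cb_derivative_0)
  next
    case (Suc j)
    then have "j < cb_rank x" by simp
    from not_less_Least[OF this[unfolded cb_rank_def]] show ?thesis using Suc by simp
  qed
qed

text \<open>An infinite \<open>A\<close> would have a limit point by compactness; it lies in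
  \<open>A\<close> and is not isolated in the \<open>k\<close>-th derivative, hence lies in the next
  one.\<close>

lemma finite_closed_subset_cb_derivative:
  fixes A :: "'a::topological_space set"
  assumes "compact (UNIV :: 'a set)" "closed A"
    "A \<subseteq> cb_derivative k" "A \<inter> cb_derivative (Suc k) = {}"
  shows "finite A"
proof (rule ccontr)
  assume "infinite A"
  then obtain x where x: "x islimpt A"
    using Heine_Borel_imp_Bolzano_Weierstrass[OF assms(1)] by blast
  then have "x \<in> A" using assms(2) closed_limpt by blast
  moreover have "x islimpt cb_derivative k" using x assms(3) by (rule islimpt_subset)
  ultimately show False
    using assms(3,4) unfolding cb_derivative_Suc isolated_in_islimpt_iff by blast
qed

section \<open>Separation functions and the map to the next derivative\<close>

lemma completely_regular_bump:
  fixes x :: "'a::topological_space"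
  assumes "completely_regular_space (euclidean :: 'a topology)" "open U" "x \<in> U"
  obtains f :: "'a \<Rightarrow> real"
    where "continuous_on UNIV f" "\<And>y. 0 \<le> f y" "\<And>y. f y \<le> 1" "f x = 1" "\<And>y. y \<notin> U \<Longrightarrow> f y = 0"
proof -
  have "closedin euclidean (- U)" "x \<in> topspace euclidean - (- U)" using assms(2,3) by auto
  then obtain f :: "'a \<Rightarrow> real"
    where f: "continuous_map euclidean (top_of_set {0..1}) f" "f x = 0" "f ` (- U) \<subseteq> {1}"
    using assms(1) unfolding completely_regular_space_def by blast
  have c: "continuous_on UNIV f" and r: "\<And>y. f y \<in> {0..1}"
    using f(1) by (auto simp: continuous_map_in_subtopology)
  show thesis
    by (rule that[of "\<lambda>y. 1 - f y"]) (use c r f in \<open>auto intro!: continuous_intros\<close>)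
qed

lemma Hausdorff_closed_singleton:
  fixes x :: "'a::topological_space"
  assumes "Hausdorff_space (euclidean :: 'a topology)"
  shows "closed {x}"
  using closedin_t1_singleton[OF Hausdorff_imp_t1_space[OF assms], of x] by simp

text \<open>There are countably many pairs of points, so countably many functions separate them all.
  They form an injective continuous map into \<open>nat \<Rightarrow> real\<close>, and
  \<open>d\<close> is the pulled-back metric of that countable product.\<close>

lemma countable_tychonoff_separation:
  assumes "Hausdorff_space (euclidean :: 'a topology)"
    "completely_regular_space (euclidean :: 'a topology)"
    "countable (UNIV :: 'a set)"
  obtains d :: "'a::topological_space \<Rightarrow> 'a \<Rightarrow> real"
    where "continuous_on UNIV (\<lambda>z. d (fst z) (snd z))" "\<And>x y. 0 \<le> d x y"
      "\<And>x y. d x y = 0 \<longleftrightarrow> x = y"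
proof -
  have "\<exists>f :: 'a \<Rightarrow> real. continuous_on UNIV f \<and> (fst z \<noteq> snd z \<longrightarrow> f (fst z) \<noteq> f (snd z))"
    for z :: "'a \<times> 'a"
  proof (cases "fst z = snd z")
    case False
    have "open (- {snd z})" using Hausdorff_closed_singleton[OF assms(1), of "snd z"] by (simp only: open_Compl)
    then obtain f :: "'a \<Rightarrow> real" where "continuous_on UNIV f" "f (fst z) = 1" "f (snd z) = 0"
      using completely_regular_bump[OF assms(2), of "- {snd z}" "fst z"] False
      by (metis ComplI ComplD singletonD singletonI)
    then show ?thesis by (intro exI[of _ f]) auto
  qed (auto intro: exI[of _ "\<lambda>_. 0"])
  then obtain F :: "'a \<times> 'a \<Rightarrow> 'a \<Rightarrow> real"
    where F: "\<And>z. continuous_on UNIV (F z)"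
      "\<And>z. fst z \<noteq> snd z \<Longrightarrow> F z (fst z) \<noteq> F z (snd z)"
    by metis
  have cnt: "countable (UNIV :: ('a \<times> 'a) set)"
    using countable_SIGMA[OF assms(3), of "\<lambda>_. UNIV"] assms(3) by simp
  define e :: "'a \<Rightarrow> nat \<Rightarrow> real" where "e x = (\<lambda>n. F (from_nat_into UNIV n) x)" for x
  have ce: "continuous_on UNIV e"
    unfolding e_def by (rule continuous_on_coordinatewise_then_product) (rule F(1))
  have inj: "e x = e y \<longleftrightarrow> x = y" for x y
  proof
    assume *: "e x = e y"
    show "x = y"
    proof (rule ccontr)
      assume "x \<noteq> y"
      then have "F (x, y) x \<noteq> F (x, y) y" using F(2)[of "(x, y)"] by simp
      moreover obtain n where "from_nat_into UNIV n = (x, y)"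
        using from_nat_into_surj[OF cnt, of "(x, y)"] by auto
      ultimately show False using fun_cong[OF *, of n] by (simp add: e_def)
    qed
  qed simp
  show thesis
  proof (rule that[of "\<lambda>x y. dist (e x) (e y)"])
    show "continuous_on UNIV (\<lambda>z. dist (e (fst z)) (e (snd z)))"
      by (intro continuous_on_dist continuous_on_compose2[OF ce] continuous_intros) auto
  qed (auto simp: inj)
qed

text \<open>The pairs on which \<open>f\<close> varies by at least \<eta> form a compact set off the
  diagonal; the minimum of \<open>d\<close> there is positive and serves as \<delta>.\<close>

lemma compact_separation_uniformly_continuous:
  fixes d :: "'a::topological_space \<Rightarrow> 'a \<Rightarrow> real" and f :: "'a \<Rightarrow> 'b::metric_space"
  assumes "compact (UNIV :: 'a set)" "continuous_on UNIV (\<lambda>z. d (fst z) (snd z))"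
    "\<And>x y. 0 \<le> d x y" "\<And>x y. d x y = 0 \<longleftrightarrow> x = y" "continuous_on UNIV f" "\<eta> > 0"
  obtains \<delta> where "\<delta> > 0" "\<And>x y. d x y < \<delta> \<Longrightarrow> dist (f x) (f y) < \<eta>"
proof -
  define C where "C = {z :: 'a \<times> 'a. \<eta> \<le> dist (f (fst z)) (f (snd z))}"
  have "continuous_on UNIV (\<lambda>z :: 'a \<times> 'a. dist (f (fst z)) (f (snd z)))"
    by (intro continuous_on_dist continuous_on_compose2[OF assms(5)] continuous_intros) auto
  with continuous_on_const have "closed C" unfolding C_def by (rule closed_Collect_le)
  moreover have "compact (UNIV :: ('a \<times> 'a) set)"
    using compact_Times[OF assms(1,1)] by simp
  ultimately have "compact C" using compact_Int_closed[of UNIV C] by simp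
  show thesis
  proof (cases "C = {}")
    case True
    show thesis
    proof (rule that[of 1])
      fix x y show "dist (f x) (f y) < \<eta>"
        using True unfolding C_def by (metis (mono_tags, lifting) empty_iff fst_conv mem_Collect_eq not_le snd_conv)
    qed simp
  next
    case False
    obtain z where z: "z \<in> C" "\<forall>w\<in>C. d (fst z) (snd z) \<le> d (fst w) (snd w)"
      using continuous_attains_inf[OF \<open>compact C\<close> False continuous_on_subset[OF assms(2)]] by auto
    have "fst z \<noteq> snd z" using z(1) assms(6) by (auto simp: C_def)
    then have pos: "d (fst z) (snd z) > 0" using assms(3,4) by (metis less_eq_real_def)
    show thesis
    proof (rule that[OF pos])
      fix x y assume "d x y < d (fst z) (snd z)"
      then have "(x, y) \<notin> C" using z(2) by force
      then show "dist (f x) (f y) < \<eta>" by (simp add: C_def)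
    qed
  qed
qed

text \<open>The points of the \<open>k\<close>-th derivative at distance at least \<delta> from the
  next one form a closed set disjoint from it, hence a finite set. So \<open>p\<close> moves all but
  finitely many points by less than \<delta>, and uniform continuity does the rest.\<close>

lemma compact_countable_finite_height_retraction:
  assumes "Hausdorff_space (euclidean :: 'a topology)"
    "completely_regular_space (euclidean :: 'a topology)"
    "compact (UNIV :: 'a set)" "countable (UNIV :: 'a set)" "cb_derivative (m::nat) = ({} :: 'a set)"
  obtains p :: "'a::topological_space \<Rightarrow> 'a"
    where "\<And>x. p x = x \<or> cb_rank x < cb_rank (p x)" "finite {x. p x = x}"
      "\<And>(f :: 'a \<Rightarrow> 'b::metric_space) \<eta>. continuous_on UNIV f \<Longrightarrow> \<eta> > 0 \<Longrightarrow>
        finite {x. \<eta> \<le> dist (f x) (f (p x))}"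
proof -
  obtain d :: "'a \<Rightarrow> 'a \<Rightarrow> real" where d: "continuous_on UNIV (\<lambda>z. d (fst z) (snd z))"
      "\<And>x y. 0 \<le> d x y" "\<And>x y. d x y = 0 \<longleftrightarrow> x = y"
    using countable_tychonoff_separation[OF assms(1,2,4)] by blast
  have d1: "continuous_on UNIV (\<lambda>x. d x y)" for y
    using continuous_on_compose2[OF d(1), of UNIV "\<lambda>x. (x, y)"] by (simp add: continuous_intros)
  have d2: "continuous_on UNIV (d x)" for x
    using continuous_on_compose2[OF d(1), of UNIV "\<lambda>y. (x, y)"] by (simp add: continuous_intros)
  let ?N = "\<lambda>x. cb_derivative (Suc (cb_rank x)) :: 'a set"
  \<comment> \<open>A point with nothing above it is its own image; these become the fixed points of
    \<open>p\<close>.\<close>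
  have "\<exists>y. if ?N x = {} then y = x else y \<in> ?N x \<and> (\<forall>z\<in>?N x. d x y \<le> d x z)" for x
  proof (cases "?N x = {}")
    case False
    have "compact (?N x)"
      using compact_Int_closed[OF assms(3) closed_cb_derivative] by simp
    then have "\<exists>y\<in>?N x. \<forall>z\<in>?N x. d x y \<le> d x z"
      using False continuous_on_subset[OF d2] by (intro continuous_attains_inf) auto
    with False show ?thesis by auto
  qed simp
  then have "\<forall>x. \<exists>y. if ?N x = {} then y = x else y \<in> ?N x \<and> (\<forall>z\<in>?N x. d x y \<le> d x z)" by blast
  from choice[OF this] obtain p
    where p: "\<And>x. if ?N x = {} then p x = x else p x \<in> ?N x \<and> (\<forall>z\<in>?N x. d x (p x) \<le> d x z)"
    by auto
  have rank: "cb_rank x < cb_rank (p x)" if "?N x \<noteq> {}" for x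
  proof (rule ccontr)
    assume "\<not> ?thesis"
    then have "cb_derivative (Suc (cb_rank x)) \<subseteq> (cb_derivative (Suc (cb_rank (p x))) :: 'a set)"
      by (intro cb_derivative_decseq) simp
    moreover have "p x \<in> ?N x" using p[of x] that by simp
    ultimately show False using cb_rank_notin[OF assms(5), of "p x"] by blast
  qed
  define A where "A \<delta> k = {x \<in> cb_derivative k. \<forall>y\<in>cb_derivative (Suc k). \<delta> \<le> d x y}" for \<delta> and k :: nat
  have finA: "finite (\<Union>k\<in>{..<m}. A \<delta> k)" if "\<delta> > 0" for \<delta>
  proof (intro finite_UN_I finite_lessThan)
    fix k
    have "A \<delta> k = cb_derivative k \<inter> (\<Inter>y\<in>cb_derivative (Suc k). {x. \<delta> \<le> d x y})"
      by (auto simp: A_def)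
    also have "closed \<dots>"
      by (intro closed_Int closed_cb_derivative closed_INT ballI closed_Collect_le d1 continuous_intros)
    finally have "closed (A \<delta> k)" .
    moreover have "A \<delta> k \<inter> cb_derivative (Suc k) = {}"
    proof -
      have "\<not> \<delta> \<le> d x x" for x using d(3)[of x x] that by simp
      then show ?thesis by (auto simp: A_def)
    qed
    ultimately show "finite (A \<delta> k)"
      by (intro finite_closed_subset_cb_derivative[OF assms(3)]) (auto simp: A_def)
  qed
  have mem: "x \<in> (\<Union>k\<in>{..<m}. A \<delta> k)" if "\<And>y. y \<in> ?N x \<Longrightarrow> \<delta> \<le> d x y" for x \<delta>
    using that cb_rank_less[OF assms(5), of x] cb_rank_mem[OF assms(5), of x]
    by (auto simp: A_def intro!: bexI[of _ "cb_rank x"])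
  show thesis
  proof (rule that)
    show "p x = x \<or> cb_rank x < cb_rank (p x)" for x
      using p[of x] rank[of x] by (cases "?N x = {}") auto
    show "finite {x. p x = x}"
    \<comment> \<open>Over an empty next derivative the distance condition is vacuous, so the value
      1 is arbitrary.\<close>
    proof (rule finite_subset[OF _ finA[of 1]])
      have "?N x = {}" if "p x = x" for x using rank[of x] that by auto
      then show "{x. p x = x} \<subseteq> (\<Union>k\<in>{..<m}. A 1 k)" using mem[of _ 1] by blast
    qed simp
    fix f :: "'a \<Rightarrow> 'b" and \<eta> :: real
    assume f: "continuous_on UNIV f" "\<eta> > 0"
    obtain \<delta> where \<delta>: "\<delta> > 0" "\<And>x y. d x y < \<delta> \<Longrightarrow> dist (f x) (f y) < \<eta>"
      using compact_separation_uniformly_continuous[OF assms(3) d f] by blast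
    show "finite {x. \<eta> \<le> dist (f x) (f (p x))}"
    proof (rule finite_subset[OF _ finA[OF \<delta>(1)]], intro subsetI)
      fix x assume "x \<in> {x. \<eta> \<le> dist (f x) (f (p x))}"
      then have "\<not> d x (p x) < \<delta>" using \<delta>(2)[of x "p x"] by auto
      then have "\<And>y. y \<in> ?N x \<Longrightarrow> \<delta> \<le> d x y" using p[of x] by (auto split: if_splits)
      then show "x \<in> (\<Union>k\<in>{..<m}. A \<delta> k)" by (rule mem)
    qed
  qed
qed

text \<open>One representative per code, chosen by \<open>inv_into\<close>, forms the net.\<close>

lemma finite_code_imp_finite_net:
  assumes "finite (c ` B)" "\<And>a b. a \<in> B \<Longrightarrow> b \<in> B \<Longrightarrow> c a = c b \<Longrightarrow> dist a b \<le> e"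
  shows "\<exists>F. finite F \<and> B \<subseteq> (\<Union>a\<in>F. cball a e)"
proof (intro exI[of _ "inv_into B c ` c ` B"] conjI)
  show "finite (inv_into B c ` c ` B)" using assms(1) by simp
  show "B \<subseteq> (\<Union>a\<in>inv_into B c ` c ` B. cball a e)"
  proof
    fix b assume b: "b \<in> B"
    then have "dist (inv_into B c (c b)) b \<le> e"
      by (intro assms(2)) (auto simp: inv_into_into f_inv_into_f)
    then show "b \<in> (\<Union>a\<in>inv_into B c ` c ` B. cball a e)" using b by auto
  qed
qed

section \<open>Compact countable spaces of finite height\<close>

lemma functional_norm_on_tendsto_0_iff:
  "(\<lambda>n. functional_norm_on B (\<phi> n)) \<longlonglongrightarrow> 0 \<longleftrightarrow>
    (\<forall>e>0. \<forall>\<^sub>F n in sequentially. \<forall>f\<in>B \<union> {0}. norm (\<phi> n f) \<le> e)"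
proof
  assume L: "(\<lambda>n. functional_norm_on B (\<phi> n)) \<longlonglongrightarrow> 0"
  show "\<forall>e>0. \<forall>\<^sub>F n in sequentially. \<forall>f\<in>B \<union> {0}. norm (\<phi> n f) \<le> e"
  proof (intro allI impI)
    fix e :: real assume "e > 0"
    then have "\<forall>\<^sub>F n in sequentially. functional_norm_on B (\<phi> n) < ereal e"
      using order_tendstoD(2)[OF L, of "ereal e"] by simp
    then show "\<forall>\<^sub>F n in sequentially. \<forall>f\<in>B \<union> {0}. norm (\<phi> n f) \<le> e"
    proof eventually_elim
      case (elim n)
      show ?case
      proof
        fix f assume "f \<in> B \<union> {0}"
        then have "ereal (norm (\<phi> n f)) \<le> functional_norm_on B (\<phi> n)"
          unfolding functional_norm_on_def by (rule SUP_upper)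
        with elim have "ereal (norm (\<phi> n f)) < ereal e" by (rule le_less_trans[rotated])
        then show "norm (\<phi> n f) \<le> e" by simp
      qed
    qed
  qed
next
  assume R: "\<forall>e>0. \<forall>\<^sub>F n in sequentially. \<forall>f\<in>B \<union> {0}. norm (\<phi> n f) \<le> e"
  \<comment> \<open>The adjoined 0 keeps the supremum from being minus infinity when
    \<open>B\<close> is empty.\<close>
  have nonneg: "0 \<le> functional_norm_on B (\<phi> n)" for n
  proof -
    have "ereal (norm (\<phi> n 0)) \<le> functional_norm_on B (\<phi> n)"
      unfolding functional_norm_on_def by (rule SUP_upper) simp
    then show ?thesis by (rule order_trans[rotated]) simp
  qed
  show "(\<lambda>n. functional_norm_on B (\<phi> n)) \<longlonglongrightarrow> 0"
  proof (rule order_tendstoI)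
    fix a :: ereal assume "a < 0"
    then show "\<forall>\<^sub>F n in sequentially. a < functional_norm_on B (\<phi> n)"
      using less_le_trans[OF _ nonneg] by (intro always_eventually allI)
  next
    fix a :: ereal assume "0 < a"
    then obtain e where e: "0 < ereal e" "ereal e < a" using ereal_dense2 by blast
    then have "\<forall>\<^sub>F n in sequentially. \<forall>f\<in>B \<union> {0}. norm (\<phi> n f) \<le> e" using R by simp
    then show "\<forall>\<^sub>F n in sequentially. functional_norm_on B (\<phi> n) < a"
    proof eventually_elim
      case (elim n)
      have "functional_norm_on B (\<phi> n) \<le> ereal e"
        unfolding functional_norm_on_def using elim by (intro SUP_least) auto
      with e(2) show ?case by (rule le_less_trans[rotated])
    qed
  qed
qed

lemma linear_bcont_scale_iff:
  fixes \<phi> :: "('a::topological_space \<Rightarrow>\<^sub>C 'k::real_normed_field) \<Rightarrow> 'k"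
  shows "Vector_Spaces.linear bcont_scale (*) \<phi> \<longleftrightarrow>
    (\<forall>f g. \<phi> (f + g) = \<phi> f + \<phi> g) \<and> (\<forall>c f. \<phi> (bcont_scale c f) = c * \<phi> f)"
proof -
  have "vector_space ((*) :: 'k \<Rightarrow> 'k \<Rightarrow> 'k)"
    by unfold_locales (auto simp: algebra_simps)
  then show ?thesis
    using vector_space_bcont_scale[where 'k='k and 'a='a]
    by (simp add: Vector_Spaces.linear_def module_hom_def module_hom_axioms_def
        module_iff_vector_space)
qed

text \<open>The map \<open>q\<close> rounds bounded scalars to finitely many values; it turns
  finitely many scalars into a finite code.\<close>

lemma finite_approximation:
  fixes K :: real
  assumes "\<eta> > 0"
  obtains N :: "'k::heine_borel set" and q
    where "finite N" "\<And>v. v \<in> cball a K \<Longrightarrow> q v \<in> N" "\<And>v. v \<in> cball a K \<Longrightarrow> dist (q v) v < \<eta>"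
proof -
  obtain N where N: "finite N" "cball a K \<subseteq> (\<Union>x\<in>N. ball x \<eta>)"
    using compact_cball[of a K] assms unfolding compact_eq_totally_bounded by blast
  have "\<forall>v. \<exists>x. v \<in> cball a K \<longrightarrow> x \<in> N \<and> dist x v < \<eta>" using N(2) by fastforce
  from choice[OF this] show thesis using that[OF N(1)] by auto
qed

text \<open>Iterating \<open>p\<close> raises the rank, so from every point a bounded number of
  steps reaches a finite set \<open>G\<close> of control points. A function in \<open>B\<close>
  changes little along each step outside \<open>G\<close>.\<close>

proposition compact_countable_finite_height_strongly_GP:
  fixes T :: "('a::topological_space \<Rightarrow>\<^sub>C 'k::{real_normed_field,euclidean_space}) topology"
  assumes tych: "Hausdorff_space (euclidean :: 'a topology)"
    "completely_regular_space (euclidean :: 'a topology)"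
  and X: "compact (UNIV :: 'a set)" "countable (UNIV :: 'a set)" "finite_scattered_height TYPE('a)"
  and T: "T \<in> intermediate_lc_topologies"
  shows "strongly_Gelfand_Phillips bcont_scale T"
proof -
  obtain m :: nat where m: "cb_derivative m = ({} :: 'a set)"
    using X(3) unfolding finite_scattered_height_def by blast
  obtain p :: "'a \<Rightarrow> 'a"
    where p: "\<And>x. p x = x \<or> cb_rank x < cb_rank (p x)" "finite {x. p x = x}"
      "\<And>(f :: 'a \<Rightarrow> 'k) \<eta>. continuous_on UNIV f \<Longrightarrow> \<eta> > 0 \<Longrightarrow> finite {x. \<eta> \<le> dist (f x) (f (p x))}"
    using compact_countable_finite_height_retraction[OF tych X(1,2) m, where 'b='k] by blast
  define t :: "'a \<Rightarrow> nat" where "t = to_nat_on UNIV"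
  have inj: "inj t" unfolding t_def by (rule inj_on_to_nat_on[OF X(2)])
  define x where "x n = inv t n" for n
  have xt [simp]: "x (t y) = y" for y unfolding x_def using inj by simp
  \<comment> \<open>The space is enumerated through \<open>t\<close>; indices outside its range,
    which occur for a finite space, get the zero functional.\<close>
  define \<phi> :: "nat \<Rightarrow> ('a \<Rightarrow>\<^sub>C 'k) \<Rightarrow> 'k"
    where "\<phi> n f = (if n \<in> range t then apply_bcontfun f (x n) - apply_bcontfun f (p (x n)) else 0)" for n f
  have dual: "\<phi> n \<in> topological_dual bcont_scale T" for n
  proof -
    have "continuous_map T euclidean (\<lambda>f. apply_bcontfun f y)" for y
      by (rule intermediate_continuous[OF T continuous_map_pointwise_eval])
    then have "continuous_map T euclidean (\<phi> n)"
      unfolding \<phi>_def by (cases "n \<in> range t") (auto intro!: continuous_map_diff)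
    moreover have "Vector_Spaces.linear bcont_scale (*) (\<phi> n)"
      unfolding linear_bcont_scale_iff by (auto simp: \<phi>_def apply_bcont_scale algebra_simps)
    ultimately show ?thesis by (simp add: topological_dual_def)
  qed
  have null: "(\<lambda>n. \<phi> n f) \<longlonglongrightarrow> 0" for f
  proof (rule tendstoI)
    fix \<eta> :: real assume "\<eta> > 0"
    have "{n. \<not> dist (\<phi> n f) 0 < \<eta>} \<subseteq> t ` {y. \<eta> \<le> dist (apply_bcontfun f y) (apply_bcontfun f (p y))}"
      using \<open>\<eta> > 0\<close> by (auto simp: \<phi>_def dist_norm split: if_splits)
    moreover have "finite \<dots>" using p(3)[OF continuous_on_apply_bcontfun \<open>\<eta> > 0\<close>] by blast
    ultimately have "finite {n. \<not> dist (\<phi> n f) 0 < \<eta>}" by (rule finite_subset)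
    then show "\<forall>\<^sub>F n in sequentially. dist (\<phi> n f) 0 < \<eta>"
      by (simp only: eventually_cofinite flip: cofinite_eq_sequentially)
  qed
  have main: "barrel_precompact bcont_scale T B"
    if bB: "barrel_bounded bcont_scale T B" and lim: "(\<lambda>n. functional_norm_on B (\<phi> n)) \<longlonglongrightarrow> 0" for B
    unfolding barrel_precompact_iff_totally_bounded[OF T]
  proof (intro allI impI)
    fix e :: real assume "e > 0"
    \<comment> \<open>Chosen so that the worst accumulated error, at rank 0, is
      \<open>e\<close>.\<close>
    define \<eta> where "\<eta> = e / (2 * real m + 1)"
    have "\<eta> > 0" using \<open>e > 0\<close> by (simp add: \<eta>_def)
    have "bounded B" using bB barrel_bounded_iff_bounded[OF T] by blast
    then obtain K where K: "\<And>f. f \<in> B \<Longrightarrow> norm f \<le> K" unfolding bounded_iff by blast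
    have "\<forall>\<^sub>F n in sequentially. \<forall>f\<in>B \<union> {0}. norm (\<phi> n f) \<le> \<eta>"
      using lim \<open>\<eta> > 0\<close> unfolding functional_norm_on_tendsto_0_iff by blast
    then obtain N where N: "\<And>n f. n \<ge> N \<Longrightarrow> f \<in> B \<Longrightarrow> norm (\<phi> n f) \<le> \<eta>"
      unfolding eventually_sequentially by blast
    \<comment> \<open>Points where a step is not controlled: \<open>p\<close> does not move them, or
      their index is below \<open>N\<close>.\<close>
    define G where "G = {y. p y = y} \<union> t -` {..<N}"
    have "finite G" unfolding G_def using p(2) inj by (simp add: finite_vimageI)
    have step: "dist (apply_bcontfun f y) (apply_bcontfun f (p y)) \<le> \<eta>" if "y \<notin> G" "f \<in> B" for y f
      using N[of "t y" f] that by (simp add: G_def \<phi>_def dist_norm)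
    \<comment> \<open>At most \<open>m - cb_rank y\<close> steps lead into \<open>G\<close>. Each
      costs \<eta> for \<open>f\<close> and \<eta> for \<open>g\<close>; the final 1 is the
      closeness on \<open>G\<close>.\<close>
    have close: "dist (apply_bcontfun f y) (apply_bcontfun g y) \<le> (2 * real (m - cb_rank y) + 1) * \<eta>"
      if fg: "f \<in> B" "g \<in> B" "\<And>z. z \<in> G \<Longrightarrow> dist (apply_bcontfun f z) (apply_bcontfun g z) \<le> \<eta>"
      for f g y
    proof (induction "m - cb_rank y" arbitrary: y rule: less_induct)
      case less
      show ?case
      proof (cases "y \<in> G")
        case True
        have "1 * \<eta> \<le> (2 * real (m - cb_rank y) + 1) * \<eta>" using \<open>\<eta> > 0\<close> by (intro mult_right_mono) auto
        then show ?thesis using fg(3)[OF True] by linarith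
      next
        case False
        then have "p y \<noteq> y" by (simp add: G_def)
        then have r: "cb_rank y < cb_rank (p y)" using p(1)[of y] by simp
        then have lt: "m - cb_rank (p y) < m - cb_rank y"
          using cb_rank_less[OF m, of "p y"] by linarith
        have "dist (apply_bcontfun f y) (apply_bcontfun g y)
            \<le> dist (apply_bcontfun f y) (apply_bcontfun f (p y))
              + dist (apply_bcontfun f (p y)) (apply_bcontfun g (p y))
              + dist (apply_bcontfun g y) (apply_bcontfun g (p y))"
          using dist_triangle[of "apply_bcontfun f y" "apply_bcontfun g y" "apply_bcontfun f (p y)"]
            dist_triangle2[of "apply_bcontfun f (p y)" "apply_bcontfun g y" "apply_bcontfun g (p y)"]
          by linarith
        also have "\<dots> \<le> \<eta> + (2 * real (m - cb_rank (p y)) + 1) * \<eta> + \<eta>"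
          by (intro add_mono step False fg less lt)
        also have "\<dots> = (2 * real (m - cb_rank (p y) + 1) + 1) * \<eta>" by (simp add: algebra_simps)
        also have "\<dots> \<le> (2 * real (m - cb_rank y) + 1) * \<eta>"
          using lt \<open>\<eta> > 0\<close> by (intro mult_right_mono add_mono mult_left_mono) auto
        finally show ?thesis .
      qed
    qed
    obtain M :: "'k set" and q where M: "finite M" "\<And>v. v \<in> cball 0 K \<Longrightarrow> q v \<in> M"
        "\<And>v. v \<in> cball 0 K \<Longrightarrow> dist (q v) v < \<eta> / 2"
      using finite_approximation[of "\<eta> / 2" 0 K] \<open>\<eta> > 0\<close> by (metis half_gt_zero)
    have inK: "apply_bcontfun f y \<in> cball 0 K" if "f \<in> B" for f y
      using K[OF that] order_trans[OF norm_bounded[of f y]] by simp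
    \<comment> \<open>Rounding to within \<eta> / 2 makes the values of functions with equal codes
      \<eta>-close on \<open>G\<close>.\<close>
    define c where "c f = restrict (\<lambda>y. q (apply_bcontfun f y)) G" for f
    show "\<exists>F. finite F \<and> B \<subseteq> (\<Union>f\<in>F. cball f e)"
    proof (rule finite_code_imp_finite_net)
      have "c ` B \<subseteq> (\<Pi>\<^sub>E y\<in>G. M)" using M(2) inK by (auto simp: c_def)
      then show "finite (c ` B)" using finite_PiE[OF \<open>finite G\<close> M(1)] by (rule finite_subset)
      fix f g assume fg: "f \<in> B" "g \<in> B" "c f = c g"
      have G: "dist (apply_bcontfun f z) (apply_bcontfun g z) \<le> \<eta>" if "z \<in> G" for z
      proof -
        have "q (apply_bcontfun f z) = q (apply_bcontfun g z)"
          using fun_cong[OF fg(3), of z] that by (simp add: c_def)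
        then show ?thesis
          using M(3)[OF inK[OF fg(1), of z]] M(3)[OF inK[OF fg(2), of z]]
            dist_triangle3[of "apply_bcontfun f z" "apply_bcontfun g z" "q (apply_bcontfun f z)"]
          by simp
      qed
      show "dist f g \<le> e"
      proof (rule dist_bound)
        fix y
        have "dist (apply_bcontfun f y) (apply_bcontfun g y) \<le> (2 * real (m - cb_rank y) + 1) * \<eta>"
          by (rule close[OF fg(1,2) G])
        also have "\<dots> \<le> (2 * real m + 1) * \<eta>"
          using \<open>\<eta> > 0\<close> by (intro mult_right_mono add_mono mult_left_mono) auto
        also have "\<dots> = e" by (simp add: \<eta>_def)
        finally show "dist (apply_bcontfun f y) (apply_bcontfun g y) \<le> e" .
      qed
    qed
  qed
  show ?thesis
    unfolding strongly_Gelfand_Phillips_def weak_star_null_def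
    using dual null main by (intro exI[of _ \<phi>]) blast
qed

section \<open>Consequences of the strong Gelfand-Phillips property\<close>

definition separated_by :: "real \<Rightarrow> 'a::metric_space set \<Rightarrow> bool" where
  "separated_by e A \<longleftrightarrow> (\<forall>a\<in>A. \<forall>b\<in>A. a \<noteq> b \<longrightarrow> e \<le> dist a b)"

text \<open>Two points with a common centre are at distance at most 2 e / 3, so distinct points of
  \<open>A\<close> need distinct centres.\<close>

lemma card_separated_le_net:
  assumes "separated_by e A" "finite F" "A \<subseteq> (\<Union>f\<in>F. cball f (e / 3))" "e > 0"
  shows "card A \<le> card F"
proof -
  have "\<forall>a\<in>A. \<exists>f. f \<in> F \<and> dist f a \<le> e / 3" using assms(3) by fastforce
  from bchoice[OF this] obtain h where h: "\<And>a. a \<in> A \<Longrightarrow> h a \<in> F \<and> dist (h a) a \<le> e / 3" by blast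
  have "inj_on h A"
  proof (rule inj_onI, rule ccontr)
    fix a b assume ab: "a \<in> A" "b \<in> A" "h a = h b" "a \<noteq> b"
    have "dist a b \<le> dist (h a) a + dist (h a) b" by (rule dist_triangle3)
    also have "\<dots> \<le> e / 3 + e / 3" using h[OF ab(1)] h[OF ab(2)] ab(3) by (intro add_mono) auto
    finally show False using ab assms(1,4) unfolding separated_by_def by fastforce
  qed
  moreover have "h ` A \<subseteq> F" using h by blast
  ultimately show ?thesis using assms(2) by (rule card_inj_on_le)
qed

text \<open>Bumps and plateaus are built as real functions and transported, so one construction
  serves both scalar fields. For \<open>f\<close> not continuous and bounded the value is
  unspecified.\<close>

definition bcont_of_real :: "('a::topological_space \<Rightarrow> real) \<Rightarrow> ('a \<Rightarrow>\<^sub>C 'k::real_normed_field)" where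
  "bcont_of_real f = Bcontfun (\<lambda>x. of_real (f x))"

lemma apply_bcont_of_real:
  assumes "continuous_on UNIV f" "\<And>x. \<bar>f x\<bar> \<le> C"
  shows "apply_bcontfun (bcont_of_real f :: 'a::topological_space \<Rightarrow>\<^sub>C 'k::real_normed_field) x = of_real (f x)"
proof -
  have "(\<lambda>x. of_real (f x) :: 'k) \<in> bcontfun"
    by (rule bcontfun_normI[of _ C]) (use assms in \<open>auto intro!: continuous_intros\<close>)
  then show ?thesis by (simp add: bcont_of_real_def Bcontfun_inverse)
qed

lemma norm_bcont_of_real_le:
  assumes "continuous_on UNIV f" "\<And>x. \<bar>f x\<bar> \<le> C"
  shows "norm (bcont_of_real f :: 'a::topological_space \<Rightarrow>\<^sub>C 'k::real_normed_field) \<le> C"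
  by (rule norm_bound) (simp add: apply_bcont_of_real[OF assms] assms(2))

lemma Hausdorff_separate:
  fixes x y :: "'a::topological_space"
  assumes "Hausdorff_space (euclidean :: 'a topology)" "x \<noteq> y"
  obtains P Q where "open P" "open Q" "x \<in> P" "y \<in> Q" "P \<inter> Q = {}"
  using assms unfolding Hausdorff_space_def disjnt_def
  by (simp flip: open_openin) meson

text \<open>A neighbourhood \<open>W\<close> of \<open>x\<close> is kept in reserve. As
  \<open>x\<close> is a limit point, \<open>W\<close> contains a further point of the derivative;
  separating it from \<open>x\<close> splits off the next set and shrinks \<open>W\<close>.\<close>

lemma disjoint_neighbourhoods_near_derivative:
  fixes x :: "'a::topological_space"
  assumes "Hausdorff_space (euclidean :: 'a topology)"
    "x \<in> cb_derivative (Suc n)" "open U" "x \<in> U"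
  shows "\<exists>Q y W. open W \<and> x \<in> W \<and> W \<subseteq> U \<and>
    (\<forall>i<(k::nat). open (Q i) \<and> y i \<in> Q i \<and> y i \<in> cb_derivative n \<and> Q i \<subseteq> U \<and> Q i \<inter> W = {}) \<and>
    (\<forall>i<k. \<forall>j<k. i \<noteq> j \<longrightarrow> Q i \<inter> Q j = {})"
proof (induction k)
  case 0
  show ?case
    by (intro exI[of _ "\<lambda>_. U"] exI[of _ "\<lambda>_. x"] exI[of _ U] conjI assms(3,4)) simp_all
next
  case (Suc k)
  then obtain Q y W where W: "open W" "x \<in> W" "W \<subseteq> U"
    and Q': "\<forall>i<k. open (Q i) \<and> y i \<in> Q i \<and> y i \<in> cb_derivative n \<and> Q i \<subseteq> U \<and> Q i \<inter> W = {}"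
      "\<forall>i<k. \<forall>j<k. i \<noteq> j \<longrightarrow> Q i \<inter> Q j = {}"
    by (elim exE conjE) (rule that)
  note Q = Q'[rule_format]
  have "x islimpt cb_derivative n"
    using assms(2) unfolding cb_derivative_Suc isolated_in_islimpt_iff by blast
  then obtain z where z: "z \<in> cb_derivative n" "z \<in> W" "z \<noteq> x"
    using islimptE[OF _ W(2,1)] by blast
  obtain P R where PR: "open P" "open R" "z \<in> P" "x \<in> R" "P \<inter> R = {}"
    using Hausdorff_separate[OF assms(1) z(3)] by blast
  let ?Q = "Q(k := W \<inter> P)" and ?y = "y(k := z)" and ?W = "W \<inter> R"
  have 1: "open ?W" "x \<in> ?W" "?W \<subseteq> U" using W PR by auto
  have 2: "open (?Q i) \<and> ?y i \<in> ?Q i \<and> ?y i \<in> cb_derivative n \<and> ?Q i \<subseteq> U \<and> ?Q i \<inter> ?W = {}"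
    if "i < Suc k" for i
  proof (cases "i = k")
    case True
    have "open (W \<inter> P)" using W PR by auto
    with True show ?thesis using z PR W by auto
  next
    case False
    then show ?thesis using Q(1)[of i] that by auto
  qed
  have 3: "?Q i \<inter> ?Q j = {}" if "i < Suc k" "j < Suc k" "i \<noteq> j" for i j
    using that Q(1)[of i] Q(1)[of j] Q(2)[of i j] by (auto simp: less_Suc_eq)
  have all2: "\<forall>i<Suc k. open (?Q i) \<and> ?y i \<in> ?Q i \<and> ?y i \<in> cb_derivative n \<and> ?Q i \<subseteq> U \<and> ?Q i \<inter> ?W = {}"
    by (intro allI impI) (rule 2)
  have all3: "\<forall>i<Suc k. \<forall>j<Suc k. i \<noteq> j \<longrightarrow> ?Q i \<inter> ?Q j = {}"
    by (intro allI impI) (rule 3)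
  show ?case
    by (rule exI[of _ ?Q], rule exI[of _ ?y], rule exI[of _ ?W])
      (intro conjI 1 all2 all3)
qed

section \<open>Sequences of functionals that detect total boundedness\<close>

text \<open>The witnessing sequence in pure norm terms, with the topology \<open>T\<close>
  eliminated: \<open>totally_bounded\<close> is the contrapositive of the defining property once
  barrels are replaced by norm balls.\<close>

locale Gelfand_Phillips_sequence =
  fixes \<phi> :: "nat \<Rightarrow> ('a::topological_space \<Rightarrow>\<^sub>C 'k::{real_normed_field,euclidean_space}) \<Rightarrow> 'k"
    and M :: real
  assumes Hausdorff: "Hausdorff_space (euclidean :: 'a topology)"
    and regular: "completely_regular_space (euclidean :: 'a topology)"
    and add: "\<phi> n (f + g) = \<phi> n f + \<phi> n g"
    and scale: "\<phi> n (bcont_scale c f) = c * \<phi> n f"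
    and bound_nonneg: "0 \<le> M"
    and bound: "norm (\<phi> n f) \<le> M * norm f"
    and null: "(\<lambda>n. \<phi> n f) \<longlonglongrightarrow> 0"
    and totally_bounded:
      "\<lbrakk>bounded B; \<And>e. e > 0 \<Longrightarrow> \<forall>\<^sub>F n in sequentially. \<forall>f\<in>B. norm (\<phi> n f) \<le> e; e > 0\<rbrakk>
        \<Longrightarrow> \<exists>F. finite F \<and> B \<subseteq> (\<Union>f\<in>F. cball f e)"
begin

lemma scaleR: "\<phi> n (r *\<^sub>R f) = of_real r * \<phi> n f"
  using scale[of n "of_real r" f] by (simp add: bcont_scale_of_real)

lemma diff: "\<phi> n (f - g) = \<phi> n f - \<phi> n g"
  using add[of n "f - g" g] by (simp add: algebra_simps)

lemma zero: "\<phi> n 0 = 0"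
  using diff[of n 0 0] by simp

lemma sum: "\<phi> n (\<Sum>i\<in>I. f i) = (\<Sum>i\<in>I. \<phi> n (f i))"
  by (induction I rule: infinite_finite_induct) (auto simp: zero add)

lemma eventually_small:
  assumes "e > 0"
  shows "\<forall>\<^sub>F n in sequentially. norm (\<phi> n f) \<le> e"
  using tendstoD[OF null assms, of f] by eventually_elim (simp add: dist_norm)

text \<open>
  Otherwise one takes, for every \<open>k\<close>, more than \<open>k\<close> separated elements on which all
  functionals are at most \<open>1 / (k + 1)\<close>. The functionals tend to \<open>0\<close> uniformly on the
  union of these finite sets, which is bounded but not totally bounded.
\<close>

lemma card_separated_small:
  assumes "e > 0"
  shows "\<exists>\<delta>>0. \<exists>N::nat. \<forall>A. finite A \<and> separated_by e A \<and> (\<forall>a\<in>A. norm a \<le> 1) \<and>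
    (\<forall>a\<in>A. \<forall>n. norm (\<phi> n a) \<le> \<delta>) \<longrightarrow> card A \<le> N" (is "\<exists>\<delta>>0. \<exists>N. \<forall>A. ?P \<delta> A \<longrightarrow> card A \<le> N")
proof (rule ccontr)
  assume "\<not> ?thesis"
  then have "\<forall>k::nat. \<exists>A. ?P (1 / real (Suc k)) A \<and> k < card A"
    by (auto simp: not_le)
  from choice[OF this] obtain A where A: "\<And>k. ?P (1 / real (Suc k)) (A k)" "\<And>k. k < card (A k)"
    by blast
  define B where "B = (\<Union>k. A k)"
  have "bounded B"
    by (rule boundedI[of _ 1]) (use A(1) in \<open>auto simp: B_def\<close>)
  moreover have "\<forall>\<^sub>F n in sequentially. \<forall>f\<in>B. norm (\<phi> n f) \<le> \<eta>" if \<eta>: "\<eta> > 0" for \<eta>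
  proof -
    obtain K where K: "1 / real (Suc K) < \<eta>" using nat_approx_posE[OF \<eta>] by blast
    \<comment> \<open>From index \<open>K\<close> on smallness is built in; on the finitely many
      earlier elements pointwise convergence is uniform.\<close>
    have "finite (\<Union>k\<in>{..<K}. A k)" using A(1) by auto
    then have "\<forall>\<^sub>F n in sequentially. \<forall>f\<in>(\<Union>k\<in>{..<K}. A k). norm (\<phi> n f) \<le> \<eta>"
      using eventually_small[OF that] by (intro eventually_ball_finite) auto
    then show ?thesis
    proof eventually_elim
      case (elim n)
      show ?case
      proof
        fix f assume "f \<in> B"
        then obtain k where k: "f \<in> A k" by (auto simp: B_def)
        show "norm (\<phi> n f) \<le> \<eta>"
        proof (cases "k < K")
          case True
          then show ?thesis using elim k by auto
        next
          case False
          have "norm (\<phi> n f) \<le> 1 / real (Suc k)" using A(1)[of k] k by blast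
          also have "\<dots> \<le> 1 / real (Suc K)" using False by (intro divide_left_mono) auto
          finally show ?thesis using K by linarith
        qed
      qed
    qed
  qed
  ultimately obtain F where F: "finite F" "B \<subseteq> (\<Union>f\<in>F. cball f (e / 3))"
    using totally_bounded[of B "e / 3"] assms by auto
  \<comment> \<open>The set indexed by the size of the net has more separated elements than the net
    has centres.\<close>
  have "card (A (card F)) \<le> card F"
  proof (rule card_separated_le_net)
    show "separated_by e (A (card F))" using A(1) by blast
    show "A (card F) \<subseteq> (\<Union>f\<in>F. cball f (e / 3))" using F(2) unfolding B_def by blast
  qed (use F assms in auto)
  then show False using A(2)[of "card F"] by simp
qed

text \<open>
  An element is coded by an index after which the functionals are small on it, together
  with approximate values of the finitely many earlier functionals. There are countably
  many codes, and elements with the same code have a difference on which all functionals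
  are small.
\<close>

lemma countable_separated:
  fixes A :: "('a \<Rightarrow>\<^sub>C 'k) set"
  assumes "e > 0" "separated_by e A" "\<And>a. a \<in> A \<Longrightarrow> norm a \<le> 1"
  shows "countable A"
proof (rule ccontr)
  assume unc: "\<not> countable A"
  obtain \<delta> N where \<delta>: "\<delta> > 0"
    "\<forall>A. finite A \<and> separated_by (e / 2) A \<and> (\<forall>a\<in>A. norm a \<le> 1) \<and>
      (\<forall>a\<in>A. \<forall>n. norm (\<phi> n a) \<le> \<delta>) \<longrightarrow> card A \<le> (N::nat)"
    using card_separated_small[OF half_gt_zero[OF assms(1)]] by blast
  define C where "C n = {a \<in> A. \<forall>j\<ge>n. norm (\<phi> j a) \<le> \<delta>}" for n
  have "A \<subseteq> (\<Union>n. C n)"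
    using eventually_small[OF \<delta>(1)] by (auto simp: C_def eventually_sequentially)
  then have "\<not> countable (\<Union>n. C n)" using unc countable_subset by blast
  then obtain n where "\<not> countable (C n)" by auto
  then have inf: "infinite (C n)" using countable_finite by blast
  obtain R :: "'k set" and q where R: "finite R" "\<And>v. v \<in> cball 0 M \<Longrightarrow> q v \<in> R"
    "\<And>v. v \<in> cball 0 M \<Longrightarrow> dist (q v) v < \<delta>"
    using finite_approximation[OF \<delta>(1)] by metis
  have inM: "\<phi> j a \<in> cball 0 M" if "a \<in> A" for j a
  proof -
    have "norm (\<phi> j a) \<le> M * norm a" by (rule bound)
    also have "\<dots> \<le> M * 1" using assms(3)[OF that] bound_nonneg by (rule mult_left_mono)
    finally show ?thesis by simp
  qed
  define c where "c a = restrict (\<lambda>j. q (\<phi> j a)) {..<n}" for a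
  have "c ` C n \<subseteq> (\<Pi>\<^sub>E j\<in>{..<n}. R)" using R(2) inM by (auto simp: c_def C_def split: if_splits)
  moreover have "finite (\<Pi>\<^sub>E j\<in>{..<n}. R)" using R(1) by (intro finite_PiE) auto
  ultimately have "finite (c ` C n)" by (rule finite_subset)
  from pigeonhole_infinite[OF inf this] obtain b
    where b: "b \<in> C n" "infinite {a \<in> C n. c a = c b}" by blast
  \<comment> \<open>Halving brings differences back into the unit ball and the bound 2 \<delta> down
    to \<delta>; the price is separation \<open>e / 2\<close>, for which \<delta> and
    \<open>N\<close> were chosen.\<close>
  let ?h = "\<lambda>a. (1/2) *\<^sub>R (a - b)"
  obtain D where D: "D \<subseteq> {a \<in> C n. c a = c b}" "finite D" "card D = Suc N"
    using infinite_arbitrarily_large[OF b(2)] by blast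
  have DA: "a \<in> A" if "a \<in> D" for a using D(1) that by (auto simp: C_def)
  have bA: "b \<in> A" using b(1) by (simp add: C_def)
  have "inj ?h" by (rule injI) simp
  then have card: "card (?h ` D) = Suc N" using D(3) by (simp add: card_image inj_on_subset)
  have "card (?h ` D) \<le> N"
  proof (rule \<delta>(2)[rule_format], intro conjI ballI allI)
    show "finite (?h ` D)" using D(2) by simp
    show "separated_by (e / 2) (?h ` D)"
      unfolding separated_by_def
    proof safe
      fix a a' assume a: "a \<in> D" "a' \<in> D" "?h a \<noteq> ?h a'"
      then have "e \<le> dist a a'" using assms(2) DA unfolding separated_by_def by auto
      moreover have "dist (?h a) (?h a') = dist a a' / 2"
        unfolding dist_norm by (simp flip: scaleR_right_diff_distrib)
      ultimately show "e / 2 \<le> dist (?h a) (?h a')" by simp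
    qed
  next
    fix f assume "f \<in> ?h ` D"
    then obtain a where a: "a \<in> D" "f = ?h a" by blast
    have "norm (a - b) \<le> 1 + 1"
      by (rule norm_triangle_le_diff) (use assms(3)[OF DA[OF a(1)]] assms(3)[OF bA] in linarith)
    then show "norm f \<le> 1" unfolding a(2) by simp
    fix j
    have "norm (\<phi> j a - \<phi> j b) \<le> 2 * \<delta>"
    proof (cases "j < n")
      case True
      have "c a = c b" using D(1) a(1) by blast
      from fun_cong[OF this, of j] have "q (\<phi> j a) = q (\<phi> j b)" using True by (simp add: c_def)
      then show ?thesis
        using R(3)[OF inM[OF DA[OF a(1)], of j]] R(3)[OF inM[OF bA, of j]]
          dist_triangle3[of "\<phi> j a" "\<phi> j b" "q (\<phi> j a)"]
        by (simp add: dist_norm)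
    next
      case False
      then have "norm (\<phi> j a) \<le> \<delta>" "norm (\<phi> j b) \<le> \<delta>"
        using D(1) a(1) b(1) by (auto simp: C_def)
      then show ?thesis using norm_triangle_ineq4[of "\<phi> j a" "\<phi> j b"] by linarith
    qed
    moreover have "norm (\<phi> j f) = norm (\<phi> j a - \<phi> j b) / 2"
      unfolding a(2) scaleR diff by (simp add: norm_mult norm_divide)
    ultimately show "norm (\<phi> j f) \<le> \<delta>" by simp
  qed
  with card show False by simp
qed

lemma countable_separated_functions:
  fixes h :: "'i \<Rightarrow> 'a \<Rightarrow> real"
  assumes "\<And>i. i \<in> I \<Longrightarrow> continuous_on UNIV (h i)"
    "\<And>i x. i \<in> I \<Longrightarrow> 0 \<le> h i x" "\<And>i x. i \<in> I \<Longrightarrow> h i x \<le> 1"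
    "\<And>i j. i \<in> I \<Longrightarrow> j \<in> I \<Longrightarrow> i \<noteq> j \<Longrightarrow> \<exists>x. 1 \<le> \<bar>h i x - h j x\<bar>"
  shows "countable I"
proof -
  let ?F = "\<lambda>i. bcont_of_real (h i) :: 'a \<Rightarrow>\<^sub>C 'k"
  have b: "\<bar>h i x\<bar> \<le> 1" if "i \<in> I" for i x using assms(2,3)[OF that, of x] by simp
  have sep: "1 \<le> dist (?F i) (?F j)" if ij: "i \<in> I" "j \<in> I" "i \<noteq> j" for i j
  proof -
    obtain x where x: "1 \<le> \<bar>h i x - h j x\<bar>" using assms(4)[OF ij] by blast
    also have "\<bar>h i x - h j x\<bar> = dist (apply_bcontfun (?F i) x) (apply_bcontfun (?F j) x)"
      unfolding apply_bcont_of_real[OF assms(1)[OF ij(1)] b[OF ij(1)]]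
        apply_bcont_of_real[OF assms(1)[OF ij(2)] b[OF ij(2)]] dist_norm
      by (simp flip: of_real_diff)
    also have "\<dots> \<le> dist (?F i) (?F j)" by (rule dist_bounded)
    finally show ?thesis .
  qed
  have "inj_on ?F I"
  proof (rule inj_onI, rule ccontr)
    fix i j assume "i \<in> I" "j \<in> I" "?F i = ?F j" "i \<noteq> j"
    then show False using sep[of i j] by simp
  qed
  moreover have "countable (?F ` I)"
  proof (rule countable_separated[of 1])
    show "separated_by 1 (?F ` I)"
      unfolding separated_by_def
    proof safe
      fix i j assume "i \<in> I" "j \<in> I" "?F i \<noteq> ?F j"
      then show "1 \<le> dist (?F i) (?F j)" using sep[of i j] by auto
    qed
    show "norm f \<le> 1" if f: "f \<in> ?F ` I" for f
    proof -
      obtain i where i: "i \<in> I" "f = ?F i" using f by blast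
      show ?thesis unfolding i(2) by (rule norm_bcont_of_real_le[OF assms(1) b]) (rule i(1))+
    qed
  qed simp
  ultimately show ?thesis by (simp add: countable_image_inj_eq)
qed

section \<open>Disjoint supports and finite height\<close>

text \<open>Scalars of modulus at most 1 turn every value of the functional into its norm. At each
  point at most one summand of the combination is nonzero, so its norm stays below
  \<open>C\<close>.\<close>

lemma sum_norm_disjoint_le:
  fixes f :: "nat \<Rightarrow> ('a \<Rightarrow>\<^sub>C 'k)"
  assumes "\<And>i. i < k \<Longrightarrow> norm (f i) \<le> C" "0 \<le> C"
    "\<And>i j x. i < k \<Longrightarrow> j < k \<Longrightarrow> i \<noteq> j \<Longrightarrow> apply_bcontfun (f i) x = 0 \<or> apply_bcontfun (f j) x = 0"
  shows "(\<Sum>i<k. norm (\<phi> n (f i))) \<le> M * C"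
proof -
  define c where "c i = (if \<phi> n (f i) = 0 then 0 else of_real (norm (\<phi> n (f i))) / \<phi> n (f i))" for i
  have c1: "norm (c i) \<le> 1" for i by (simp add: c_def norm_divide)
  have c2: "c i * \<phi> n (f i) = of_real (norm (\<phi> n (f i)))" for i by (simp add: c_def)
  define g where "g = (\<Sum>i<k. bcont_scale (c i) (f i))"
  have app: "apply_bcontfun (\<Sum>i\<in>I. bcont_scale (c i) (f i)) x = (\<Sum>i\<in>I. c i * apply_bcontfun (f i) x)"
    for I :: "nat set" and x
    by (induction I rule: infinite_finite_induct) (auto simp: apply_bcont_scale)
  have "norm g \<le> C"
  proof (rule norm_bound)
    fix x
    show "norm (apply_bcontfun g x) \<le> C"
    proof (cases "\<exists>i<k. apply_bcontfun (f i) x \<noteq> 0")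
      case True
      then obtain i where i: "i < k" "apply_bcontfun (f i) x \<noteq> 0" by blast
      have "apply_bcontfun g x = (\<Sum>j\<in>{i}. c j * apply_bcontfun (f j) x)"
        unfolding g_def app
        by (rule sum.mono_neutral_right) (use i assms(3)[of i] in auto)
      also have "norm \<dots> \<le> 1 * norm (f i)"
        by (simp add: norm_mult) (use mult_mono[OF c1 norm_bounded] in fastforce)
      finally show ?thesis using assms(1)[OF i(1)] by simp
    next
      case False
      then have "apply_bcontfun g x = 0" unfolding g_def app by (intro sum.neutral) auto
      then show ?thesis using assms(2) by simp
    qed
  qed
  have "\<phi> n g = of_real (\<Sum>i<k. norm (\<phi> n (f i)))"
    by (simp add: g_def sum scale c2)
  then have "(\<Sum>i<k. norm (\<phi> n (f i))) = norm (\<phi> n g)"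
    by (simp only: norm_of_real) (simp add: sum_nonneg)
  also have "\<dots> \<le> M * norm g" by (rule bound)
  also have "\<dots> \<le> M * C" using \<open>norm g \<le> C\<close> bound_nonneg by (rule mult_left_mono)
  finally show ?thesis .
qed

text \<open>Double counting: if every \<open>f i\<close> were large for some functional, the sum
  over both indices would be at least \<open>k * e\<close>, against at most
  \<open>N * (M * C)\<close>.\<close>

lemma disjoint_family_small_member:
  fixes f :: "nat \<Rightarrow> ('a \<Rightarrow>\<^sub>C 'k)"
  assumes "\<And>i. i < k \<Longrightarrow> norm (f i) \<le> C" "0 \<le> C"
    "\<And>i j x. i < k \<Longrightarrow> j < k \<Longrightarrow> i \<noteq> j \<Longrightarrow> apply_bcontfun (f i) x = 0 \<or> apply_bcontfun (f j) x = 0"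
    "real N * (M * C) < real k * e"
  shows "\<exists>i<k. \<forall>n<N. norm (\<phi> n (f i)) \<le> e"
proof (rule ccontr)
  assume "\<not> ?thesis"
  then have *: "\<exists>n<N. e < norm (\<phi> n (f i))" if "i < k" for i using that by (auto simp: not_le)
  have ge: "e \<le> (\<Sum>n<N. norm (\<phi> n (f i)))" if i: "i < k" for i
  proof -
    obtain n where "n < N" "e < norm (\<phi> n (f i))" using *[OF i] by blast
    moreover have "norm (\<phi> n (f i)) \<le> (\<Sum>n<N. norm (\<phi> n (f i)))"
      using \<open>n < N\<close> by (intro member_le_sum) auto
    ultimately show ?thesis by linarith
  qed
  have "real k * e = (\<Sum>i<k. e)" by simp
  also have "\<dots> \<le> (\<Sum>i<k. \<Sum>n<N. norm (\<phi> n (f i)))" using ge by (intro sum_mono) auto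
  also have "\<dots> = (\<Sum>n<N. \<Sum>i<k. norm (\<phi> n (f i)))" by (rule sum.swap)
  also have "\<dots> \<le> (\<Sum>n<N. M * C)" by (intro sum_mono sum_norm_disjoint_le assms)
  also have "\<dots> = real N * (M * C)" by simp
  finally show False using assms(4) by simp
qed

text \<open>
  Induction on \<open>n\<close>: to a plateau function \<open>h\<close> around \<open>x\<close> one adds a function of height
  \<open>n + 1\<close> supported where \<open>h = 1\<close>. All but the first \<open>N\<close> functionals are small on \<open>h\<close>,
  and the first \<open>N\<close> are small on one of many disjointly supported candidates, so the
  bound \<open>M\<close> on the functionals is not exceeded by more than \<open>\<epsilon>\<close> while the height grows.
\<close>

lemma high_function_near_derivative:
  assumes "x \<in> cb_derivative n" "open U" "x \<in> U" "\<epsilon> > 0"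
  shows "\<exists>(f :: 'a \<Rightarrow> real) y. continuous_on UNIV f \<and> (\<forall>z. 0 \<le> f z \<and> f z \<le> real (Suc n)) \<and>
    (\<forall>z. z \<notin> U \<longrightarrow> f z = 0) \<and> f y = real (Suc n) \<and> (\<forall>j. norm (\<phi> j (bcont_of_real f)) \<le> M + \<epsilon>)"
  using assms
proof (induction n arbitrary: x U \<epsilon>)
  case 0
  obtain f :: "'a \<Rightarrow> real" where f: "continuous_on UNIV f" "\<And>y. 0 \<le> f y" "\<And>y. f y \<le> 1" "f x = 1"
    "\<And>y. y \<notin> U \<Longrightarrow> f y = 0"
    using completely_regular_bump[OF regular 0(2,3)] by blast
  have "norm (bcont_of_real f :: 'a \<Rightarrow>\<^sub>C 'k) \<le> 1"
    by (rule norm_bcont_of_real_le[OF f(1)]) (simp add: f(2,3))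
  then have "M * norm (bcont_of_real f :: 'a \<Rightarrow>\<^sub>C 'k) \<le> M * 1" using bound_nonneg by (rule mult_left_mono)
  then have "norm (\<phi> j (bcont_of_real f)) \<le> M + \<epsilon>" for j
    using bound[of j "bcont_of_real f"] \<open>\<epsilon> > 0\<close> by linarith
  then show ?case using f by (intro exI[of _ f] exI[of _ x]) simp
next
  case (Suc n)
  obtain h0 :: "'a \<Rightarrow> real" where h0: "continuous_on UNIV h0" "\<And>y. 0 \<le> h0 y" "\<And>y. h0 y \<le> 1" "h0 x = 1"
    "\<And>y. y \<notin> U \<Longrightarrow> h0 y = 0"
    using completely_regular_bump[OF regular Suc.prems(2,3)] by blast
  \<comment> \<open>Truncating twice the bump gives a plateau: \<open>h\<close> is 1 on the whole
    open set \<open>V\<close>, which leaves room for the next function.\<close>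
  define h where "h z = min 1 (2 * h0 z)" for z
  define V where "V = {z. 1 / 2 < h0 z}"
  have ch: "continuous_on UNIV h" unfolding h_def using h0(1) by (intro continuous_intros)
  have h01: "0 \<le> h z" "h z \<le> 1" for z using h0(2)[of z] by (auto simp: h_def)
  have absh: "\<bar>h z\<bar> \<le> 1" for z using h01[of z] by simp
  have hV: "h z = 1" if "z \<in> V" for z using that by (auto simp: h_def V_def)
  have hU: "h z = 0" if "z \<notin> U" for z using h0(5)[OF that] by (simp add: h_def)
  have VU: "V \<subseteq> U" using h0(5) by (force simp: V_def)
  have oV: "open V" unfolding V_def using h0(1) by (intro open_Collect_less continuous_on_const)
  have xV: "x \<in> V" using h0(4) by (simp add: V_def)
  define H where "H = (bcont_of_real h :: 'a \<Rightarrow>\<^sub>C 'k)"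
  have "norm H \<le> 1" unfolding H_def by (rule norm_bcont_of_real_le[OF ch absh])
  then have "M * norm H \<le> M * 1" using bound_nonneg by (rule mult_left_mono)
  then have HM: "norm (\<phi> j H) \<le> M" for j using bound[of j H] by linarith
  have e2: "\<epsilon> / 2 > 0" using Suc.prems(4) by simp
  obtain N where N: "\<And>j. j \<ge> N \<Longrightarrow> norm (\<phi> j H) \<le> \<epsilon> / 2"
    using eventually_small[OF e2, of H] unfolding eventually_sequentially by blast
  \<comment> \<open>Enough candidates of norm at most n + 1 for the counting argument to yield one
    that is small for the first \<open>N\<close> functionals.\<close>
  obtain k :: nat where "real N * (M * real (Suc n)) / (\<epsilon> / 2) < real k"
    using reals_Archimedean2 by blast
  then have k: "real N * (M * real (Suc n)) < real k * (\<epsilon> / 2)"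
    unfolding pos_divide_less_eq[OF e2] .
  obtain Q y W where Q':
    "\<forall>i<k. open (Q i) \<and> y i \<in> Q i \<and> y i \<in> cb_derivative n \<and> Q i \<subseteq> V \<and> Q i \<inter> W = {}"
    "\<forall>i<k. \<forall>j<k. i \<noteq> j \<longrightarrow> Q i \<inter> Q j = {}"
    using disjoint_neighbourhoods_near_derivative[OF Hausdorff Suc.prems(1) oV xV, of k]
    by (elim exE conjE) (rule that)
  note Q = Q'[rule_format]
  have "\<forall>i. \<exists>f :: 'a \<Rightarrow> real. i < k \<longrightarrow> continuous_on UNIV f \<and> (\<forall>z. 0 \<le> f z \<and> f z \<le> real (Suc n)) \<and>
      (\<forall>z. z \<notin> Q i \<longrightarrow> f z = 0) \<and> (\<exists>y. f y = real (Suc n)) \<and> (\<forall>j. norm (\<phi> j (bcont_of_real f)) \<le> M + \<epsilon> / 2)"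
  proof
    fix i
    show "\<exists>f :: 'a \<Rightarrow> real. i < k \<longrightarrow> continuous_on UNIV f \<and> (\<forall>z. 0 \<le> f z \<and> f z \<le> real (Suc n)) \<and>
      (\<forall>z. z \<notin> Q i \<longrightarrow> f z = 0) \<and> (\<exists>y. f y = real (Suc n)) \<and> (\<forall>j. norm (\<phi> j (bcont_of_real f)) \<le> M + \<epsilon> / 2)"
    proof (cases "i < k")
      case True
      then have "y i \<in> cb_derivative n" "open (Q i)" "y i \<in> Q i" using Q(1) by auto
      from Suc.IH[OF this e2] show ?thesis by blast
    qed simp
  qed
  from choice[OF this] obtain f :: "nat \<Rightarrow> 'a \<Rightarrow> real"
    where f: "\<And>i. i < k \<Longrightarrow> continuous_on UNIV (f i)"
      "\<And>i z. i < k \<Longrightarrow> 0 \<le> f i z" "\<And>i z. i < k \<Longrightarrow> f i z \<le> real (Suc n)"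
      "\<And>i z. i < k \<Longrightarrow> z \<notin> Q i \<Longrightarrow> f i z = 0" "\<And>i. i < k \<Longrightarrow> \<exists>y. f i y = real (Suc n)"
      "\<And>i j. i < k \<Longrightarrow> norm (\<phi> j (bcont_of_real (f i))) \<le> M + \<epsilon> / 2"
    by blast
  have absf: "\<bar>f i z\<bar> \<le> real (Suc n)" if "i < k" for i z using f(2,3)[OF that, of z] by simp
  have "\<exists>i<k. \<forall>j<N. norm (\<phi> j (bcont_of_real (f i))) \<le> \<epsilon> / 2"
  proof (rule disjoint_family_small_member[OF _ _ _ k])
    fix i assume "i < k"
    show "norm (bcont_of_real (f i) :: 'a \<Rightarrow>\<^sub>C 'k) \<le> real (Suc n)"
      by (rule norm_bcont_of_real_le[OF f(1) absf]) (rule \<open>i < k\<close>)+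
  next
    fix i j z assume ij: "i < k" "j < k" "i \<noteq> j"
    have "z \<notin> Q i \<or> z \<notin> Q j" using Q(2)[OF ij] by blast
    then have "f i z = 0 \<or> f j z = 0" using f(4) ij by blast
    then show "apply_bcontfun (bcont_of_real (f i) :: 'a \<Rightarrow>\<^sub>C 'k) z = 0
      \<or> apply_bcontfun (bcont_of_real (f j) :: 'a \<Rightarrow>\<^sub>C 'k) z = 0"
      unfolding apply_bcont_of_real[OF f(1)[OF ij(1)] absf[OF ij(1)]]
        apply_bcont_of_real[OF f(1)[OF ij(2)] absf[OF ij(2)]] by simp
  qed simp
  then obtain i where i: "i < k" "\<And>j. j < N \<Longrightarrow> norm (\<phi> j (bcont_of_real (f i))) \<le> \<epsilon> / 2" by blast
  obtain w where w: "f i w = real (Suc n)" using f(5)[OF i(1)] by blast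
  \<comment> \<open>The peak of \<open>f i\<close> sits on the plateau of \<open>h\<close>, so the
    heights add.\<close>
  have "w \<in> V"
  proof -
    have "w \<in> Q i" using f(4)[OF i(1), of w] w by (cases "w \<in> Q i") auto
    then show ?thesis using Q(1)[OF i(1)] by blast
  qed
  let ?g = "\<lambda>z. h z + f i z"
  have cg: "continuous_on UNIV ?g" using ch f(1)[OF i(1)] by (intro continuous_intros)
  have g0: "0 \<le> ?g z" "?g z \<le> real (Suc (Suc n))" for z
    using h01[of z] f(2,3)[OF i(1), of z] by auto
  have absg: "\<bar>?g z\<bar> \<le> real (Suc (Suc n))" for z using g0[of z] by simp
  have "bcont_of_real ?g = H + bcont_of_real (f i)"
    by (rule bcontfun_eqI)
      (simp add: H_def apply_bcont_of_real[OF cg absg] apply_bcont_of_real[OF ch absh]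
        apply_bcont_of_real[OF f(1)[OF i(1)] absf[OF i(1)]])
  then have eq: "\<phi> j (bcont_of_real ?g) = \<phi> j H + \<phi> j (bcont_of_real (f i))" for j
    by (simp add: add)
  \<comment> \<open>Below \<open>N\<close> the plateau contributes \<open>M\<close> and the chosen
    \<open>f i\<close> only \<epsilon> / 2; from \<open>N\<close> on it is \<epsilon> / 2 and M +
    \<epsilon> / 2.\<close>
  have gM: "norm (\<phi> j (bcont_of_real ?g)) \<le> M + \<epsilon>" for j
  proof (cases "j < N")
    case True
    then show ?thesis unfolding eq
      using norm_triangle_ineq[of "\<phi> j H" "\<phi> j (bcont_of_real (f i))"] HM[of j] i(2)[OF True] e2 by linarith
  next
    case False
    then have "norm (\<phi> j H) \<le> \<epsilon> / 2" using N by simp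
    then show ?thesis unfolding eq
      using norm_triangle_ineq[of "\<phi> j H" "\<phi> j (bcont_of_real (f i))"] f(6)[OF i(1), of j] by linarith
  qed
  have gU: "?g z = 0" if "z \<notin> U" for z
  proof -
    have "z \<notin> Q i" using Q(1)[OF i(1)] VU that by blast
    then show ?thesis using hU[OF that] f(4)[OF i(1)] by simp
  qed
  have gw: "?g w = real (Suc (Suc n))" using hV[OF \<open>w \<in> V\<close>] w by simp
  have "\<forall>z. 0 \<le> ?g z \<and> ?g z \<le> real (Suc (Suc n))" using g0 by blast
  moreover have "\<forall>z. z \<notin> U \<longrightarrow> ?g z = 0" using gU by blast
  moreover have "\<forall>j. norm (\<phi> j (bcont_of_real ?g)) \<le> M + \<epsilon>" using gM by blast
  ultimately show ?case using cg gw by blast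
qed

text \<open>A point of a high derivative yields N + 1 disjointly supported functions of height n +
  1. Rescaled to norm 1 they are 1-separated and almost annihilated, one more than \<open>N\<close>
  permits.\<close>

lemma finite_height: "\<exists>n::nat. cb_derivative n = ({} :: 'a set)"
proof -
  obtain \<delta> N where \<delta>: "\<delta> > 0"
    "\<forall>A. finite A \<and> separated_by 1 A \<and> (\<forall>a\<in>A. norm a \<le> 1) \<and>
      (\<forall>a\<in>A. \<forall>n. norm (\<phi> n a) \<le> \<delta>) \<longrightarrow> card A \<le> (N::nat)"
    using card_separated_small[OF zero_less_one] by blast
  \<comment> \<open>Makes the rescaled bound (M + 1) / (n + 1) at most \<delta>.\<close>
  obtain n :: nat where "(M + 1) / \<delta> < real n" using reals_Archimedean2 by blast
  then have "M + 1 < real n * \<delta>" unfolding pos_divide_less_eq[OF \<delta>(1)] .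
  then have n: "M + 1 \<le> real (Suc n) * \<delta>" using \<delta>(1) by (simp add: distrib_right)
  have "cb_derivative (Suc n) = ({} :: 'a set)"
  proof (rule ccontr)
    assume "cb_derivative (Suc n) \<noteq> ({} :: 'a set)"
    then obtain x :: 'a where x: "x \<in> cb_derivative (Suc n)" by blast
    obtain Q y W where Q':
      "\<forall>i<Suc N. open (Q i) \<and> y i \<in> Q i \<and> y i \<in> cb_derivative n \<and> Q i \<subseteq> (UNIV :: 'a set) \<and> Q i \<inter> W = {}"
      "\<forall>i<Suc N. \<forall>j<Suc N. i \<noteq> j \<longrightarrow> Q i \<inter> Q j = {}"
      using disjoint_neighbourhoods_near_derivative[OF Hausdorff x open_UNIV UNIV_I, of "Suc N"]
      by (elim exE conjE) (rule that)
    note Q = Q'[rule_format]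
    have "\<forall>i. \<exists>f :: 'a \<Rightarrow> real. i < Suc N \<longrightarrow> continuous_on UNIV f \<and> (\<forall>z. 0 \<le> f z \<and> f z \<le> real (Suc n)) \<and>
        (\<forall>z. z \<notin> Q i \<longrightarrow> f z = 0) \<and> (\<exists>y. f y = real (Suc n)) \<and> (\<forall>j. norm (\<phi> j (bcont_of_real f)) \<le> M + 1)"
    proof
      fix i
      show "\<exists>f :: 'a \<Rightarrow> real. i < Suc N \<longrightarrow> continuous_on UNIV f \<and> (\<forall>z. 0 \<le> f z \<and> f z \<le> real (Suc n)) \<and>
        (\<forall>z. z \<notin> Q i \<longrightarrow> f z = 0) \<and> (\<exists>y. f y = real (Suc n)) \<and> (\<forall>j. norm (\<phi> j (bcont_of_real f)) \<le> M + 1)"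
      proof (cases "i < Suc N")
        case True
        then have "y i \<in> cb_derivative n" "open (Q i)" "y i \<in> Q i" using Q(1) by auto
        from high_function_near_derivative[OF this zero_less_one] show ?thesis by blast
      qed simp
    qed
    from choice[OF this] obtain f :: "nat \<Rightarrow> 'a \<Rightarrow> real"
      where f: "\<And>i. i < Suc N \<Longrightarrow> continuous_on UNIV (f i)"
        "\<And>i z. i < Suc N \<Longrightarrow> 0 \<le> f i z" "\<And>i z. i < Suc N \<Longrightarrow> f i z \<le> real (Suc n)"
        "\<And>i z. i < Suc N \<Longrightarrow> z \<notin> Q i \<Longrightarrow> f i z = 0" "\<And>i. i < Suc N \<Longrightarrow> \<exists>y. f i y = real (Suc n)"
        "\<And>i j. i < Suc N \<Longrightarrow> norm (\<phi> j (bcont_of_real (f i))) \<le> M + 1"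
      by blast
    have absf: "\<bar>f i z\<bar> \<le> real (Suc n)" if "i < Suc N" for i z using f(2,3)[OF that, of z] by simp
    define g :: "nat \<Rightarrow> 'a \<Rightarrow>\<^sub>C 'k" where "g i = (1 / real (Suc n)) *\<^sub>R bcont_of_real (f i)" for i
    have app: "apply_bcontfun (g i) z = of_real (f i z / real (Suc n))" if "i < Suc N" for i z
      by (simp add: g_def apply_bcont_of_real[OF f(1)[OF that] absf[OF that]] scaleR_conv_of_real)
    have dist_g: "1 \<le> dist (g i) (g j)" if ij: "i < Suc N" "j < Suc N" "i \<noteq> j" for i j
    proof -
      obtain z where z: "f i z = real (Suc n)" using f(5)[OF ij(1)] by blast
      then have "z \<in> Q i" using f(4)[OF ij(1), of z] by (cases "z \<in> Q i") auto
      then have "f j z = 0" using Q(2)[OF ij] f(4)[OF ij(2)] by blast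
      then have "dist (apply_bcontfun (g i) z) (apply_bcontfun (g j) z) = 1"
        unfolding app[OF ij(1)] app[OF ij(2)] z by simp
      then show ?thesis using dist_bounded[of "g i" z "g j"] by simp
    qed
    have inj: "inj_on g {..<Suc N}"
    proof (rule inj_onI, rule ccontr)
      fix i j assume "i \<in> {..<Suc N}" "j \<in> {..<Suc N}" "g i = g j" "i \<noteq> j"
      then show False using dist_g[of i j] by simp
    qed
    have "card (g ` {..<Suc N}) \<le> N"
    proof (rule \<delta>(2)[rule_format], intro conjI ballI allI)
      show "separated_by 1 (g ` {..<Suc N})"
        unfolding separated_by_def
      proof safe
        fix i j assume "i < Suc N" "j < Suc N" "g i \<noteq> g j"
        then show "1 \<le> dist (g i) (g j)" using dist_g[of i j] by auto
      qed
    next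
      fix a assume "a \<in> g ` {..<Suc N}"
      then obtain i where i: "i < Suc N" "a = g i" by blast
      have "norm (bcont_of_real (f i) :: 'a \<Rightarrow>\<^sub>C 'k) \<le> real (Suc n)"
        by (rule norm_bcont_of_real_le[OF f(1) absf]) (rule i(1))+
      then show "norm a \<le> 1" unfolding i(2) g_def by simp
      fix j
      have "norm (\<phi> j a) = norm (\<phi> j (bcont_of_real (f i))) / real (Suc n)"
        unfolding i(2) g_def scaleR by (simp add: norm_mult norm_divide flip: of_nat_Suc)
      also have "\<dots> \<le> (M + 1) / real (Suc n)" using f(6)[OF i(1)] by (intro divide_right_mono) auto
      also have "\<dots> \<le> \<delta>" using n by (simp add: pos_divide_le_eq mult.commute)
      finally show "norm (\<phi> j a) \<le> \<delta>" .
    qed simp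
    then show False by (simp add: card_image[OF inj])
  qed
  then show ?thesis by blast
qed

section \<open>Countability and compactness of the space\<close>

text \<open>Within a layer every point has a bump vanishing at the other points of that layer, so
  the bumps are 1-separated.\<close>

lemma countable_space: "countable (UNIV :: 'a set)"
proof -
  obtain m :: nat where m: "cb_derivative m = ({} :: 'a set)" using finite_height by blast
  define L :: "nat \<Rightarrow> 'a set" where "L n = cb_derivative n - cb_derivative (Suc n)" for n
  have cL: "countable (L n)" for n
  proof -
    have "\<forall>x. \<exists>f :: 'a \<Rightarrow> real. x \<in> L n \<longrightarrow> continuous_on UNIV f \<and> (\<forall>z. 0 \<le> f z \<and> f z \<le> 1) \<and>
        f x = 1 \<and> (\<forall>z\<in>L n. z \<noteq> x \<longrightarrow> f z = 0)"
    proof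
      fix x
      show "\<exists>f :: 'a \<Rightarrow> real. x \<in> L n \<longrightarrow> continuous_on UNIV f \<and> (\<forall>z. 0 \<le> f z \<and> f z \<le> 1) \<and>
        f x = 1 \<and> (\<forall>z\<in>L n. z \<noteq> x \<longrightarrow> f z = 0)"
      proof (cases "x \<in> L n")
        case True
        then have "x isolated_in cb_derivative n" by (auto simp: L_def cb_derivative_Suc)
        then obtain V where V: "open V" "V \<inter> cb_derivative n = {x}" unfolding isolated_in_def by blast
        then have "x \<in> V" by blast
        obtain f :: "'a \<Rightarrow> real" where f: "continuous_on UNIV f" "\<And>y. 0 \<le> f y" "\<And>y. f y \<le> 1" "f x = 1"
          "\<And>y. y \<notin> V \<Longrightarrow> f y = 0"
          using completely_regular_bump[OF regular V(1) \<open>x \<in> V\<close>] by blast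
        have "f z = 0" if "z \<in> L n" "z \<noteq> x" for z
          using that V(2) by (intro f(5)) (auto simp: L_def)
        then show ?thesis using f by (intro exI[of _ f]) auto
      qed simp
    qed
    from choice[OF this] obtain h :: "'a \<Rightarrow> 'a \<Rightarrow> real"
      where h: "\<And>x. x \<in> L n \<Longrightarrow> continuous_on UNIV (h x)" "\<And>x z. x \<in> L n \<Longrightarrow> 0 \<le> h x z"
        "\<And>x z. x \<in> L n \<Longrightarrow> h x z \<le> 1" "\<And>x. x \<in> L n \<Longrightarrow> h x x = 1"
        "\<And>x z. x \<in> L n \<Longrightarrow> z \<in> L n \<Longrightarrow> z \<noteq> x \<Longrightarrow> h x z = 0"
      by blast
    show ?thesis
    proof (rule countable_separated_functions[of _ h])
      fix i j assume ij: "i \<in> L n" "j \<in> L n" "i \<noteq> j"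
      have "\<bar>h i i - h j i\<bar> = 1" using h(4)[OF ij(1)] h(5)[OF ij(2,1,3)] by simp
      then show "\<exists>x. 1 \<le> \<bar>h i x - h j x\<bar>" by (intro exI[of _ i]) simp
    qed (use h in auto)
  qed
  have "(UNIV :: 'a set) = (\<Union>n. L n)"
    using cb_rank_mem[OF m] cb_rank_notin[OF m] by (auto simp: L_def)
  also have "countable \<dots>" by (intro countable_UN cL) simp
  finally show ?thesis .
qed

text \<open>
  The range of a continuous real function on a countable space omits a value in every
  interval; cutting at such a value gives clopen sets.
\<close>

lemma clopen_neighbourhood:
  fixes x :: 'a
  assumes "open U" "x \<in> U"
  obtains D where "open D" "closed D" "x \<in> D" "D \<subseteq> U"
proof -
  obtain f :: "'a \<Rightarrow> real" where f: "continuous_on UNIV f" "\<And>y. 0 \<le> f y" "\<And>y. f y \<le> 1" "f x = 1"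
    "\<And>y. y \<notin> U \<Longrightarrow> f y = 0"
    using completely_regular_bump[OF regular assms] by blast
  have "countable (range f)" using countable_space by simp
  moreover have "uncountable {0<..<1::real}" by (simp add: uncountable_open_interval)
  ultimately obtain r where r: "0 < r" "r < 1" "r \<notin> range f"
    by (metis countable_subset greaterThanLessThan_iff subsetI)
  have eq: "{y. r < f y} = {y. r \<le> f y}" using r(3) by (auto simp: less_le)
  show thesis
  proof (rule that)
    show "open {y. r < f y}" using f(1) by (intro open_Collect_less continuous_on_const)
    show "closed {y. r < f y}" unfolding eq using f(1) by (intro closed_Collect_le continuous_on_const)
    show "x \<in> {y. r < f y}" using f(4) r by simp
    show "{y. r < f y} \<subseteq> U" using f(5) r by force
  qed
qed

text \<open>Unions of pieces are clopen, since the complement is the union over the complementary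
  indices. Distinct sets of nonempty pieces give 1-separated indicators, so an infinite index set
  would have a countable power set.\<close>

lemma finite_clopen_partition:
  fixes E :: "nat \<Rightarrow> 'a set"
  assumes "\<And>n. open (E n)" "(\<Union>n. E n) = UNIV" "\<And>m n. m \<noteq> n \<Longrightarrow> E m \<inter> E n = {}"
  shows "finite {n. E n \<noteq> {}}"
proof (rule ccontr)
  let ?J = "{n. E n \<noteq> {}}"
  assume inf: "infinite ?J"
  let ?U = "\<lambda>S. \<Union>n\<in>S. E n"
  have "countable (Pow ?J)"
  proof (rule countable_separated_functions[of _ "\<lambda>S. indicator (?U S)"])
    fix S
    have "- ?U S = ?U (- S)"
    proof (intro set_eqI iffI)
      fix x assume "x \<in> - ?U S"
      moreover obtain n where "x \<in> E n" using assms(2) by blast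
      ultimately show "x \<in> ?U (- S)" by auto
    next
      fix x assume "x \<in> ?U (- S)"
      then obtain n where n: "n \<notin> S" "x \<in> E n" by blast
      have "x \<notin> E m" if "m \<in> S" for m
        using assms(3)[of m n] n that by auto
      then show "x \<in> - ?U S" by blast
    qed
    moreover have "open (?U S)" "open (?U (- S))" using assms(1) by auto
    ultimately have op: "open (?U S)" "open (- ?U S)" by simp_all
    show "continuous_on UNIV (indicator (?U S) :: 'a \<Rightarrow> real)"
      unfolding continuous_on_open_vimage[OF open_UNIV]
    proof (intro allI impI)
      fix B :: "real set"
      have "indicator (?U S) -` B \<inter> UNIV =
          (if 1 \<in> B then ?U S else {}) \<union> (if 0 \<in> B then - ?U S else {})"
      proof (rule set_eqI)
        fix x
        show "x \<in> indicator (?U S) -` B \<inter> UNIV \<longleftrightarrow>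
            x \<in> (if 1 \<in> B then ?U S else {}) \<union> (if 0 \<in> B then - ?U S else {})"
          by (cases "x \<in> ?U S") simp_all
      qed
      then show "open (indicator (?U S) -` B \<inter> UNIV)"
        using op by (simp only:) (intro open_Un, auto)
    qed
  next
    fix S S' assume "S \<in> Pow ?J" "S' \<in> Pow ?J" "S \<noteq> S'"
    then obtain n where n: "E n \<noteq> {}" "n \<in> S \<longleftrightarrow> n \<notin> S'" by blast
    then obtain x where x: "x \<in> E n" by blast
    have "x \<in> ?U T \<longleftrightarrow> n \<in> T" for T
    proof
      assume "x \<in> ?U T"
      then obtain m where m: "m \<in> T" "x \<in> E m" by blast
      then have "m = n" using assms(3)[of n m] x by auto
      with m(1) show "n \<in> T" by simp
    qed (use x in blast)
    then have "\<bar>indicator (?U S) x - indicator (?U S') x :: real\<bar> = 1"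
      using n(2) by (simp add: indicator_def)
    then show "\<exists>x. 1 \<le> \<bar>indicator (?U S) x - indicator (?U S') x :: real\<bar>"
      by (intro exI[of _ x]) simp
  qed (auto simp: indicator_def)
  then obtain g :: "nat \<Rightarrow> nat set" where g: "Pow ?J = range g"
    by (metis Pow_not_empty range_from_nat_into)
  obtain j :: "nat \<Rightarrow> nat" where j: "inj j" "range j \<subseteq> ?J"
    using infinite_countable_subset[OF inf] by blast
  \<comment> \<open>Cantor's diagonal set, moved into the index set along the injection
    \<open>j\<close>.\<close>
  define S where "S = {j n | n. j n \<notin> g n}"
  have "S \<in> Pow ?J" using j(2) by (auto simp: S_def)
  then obtain k where k: "S = g k" using g by auto
  have "j k \<in> S \<longleftrightarrow> j k \<notin> g k" using j(1) by (auto simp: S_def inj_eq)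
  with k show False by simp
qed

text \<open>A countable clopen refinement of the cover is made disjoint in the order of the
  enumeration. The differences stay open because the sets are clopen, and finitely many of them are
  nonempty.\<close>

lemma compact_space: "compact (UNIV :: 'a set)"
proof (rule compactI)
  fix \<C> :: "'a set set"
  assume C: "\<forall>C\<in>\<C>. open C" "UNIV \<subseteq> \<Union>\<C>"
  have "\<forall>x. \<exists>D. open D \<and> closed D \<and> x \<in> D \<and> (\<exists>C\<in>\<C>. D \<subseteq> C)"
  proof
    fix x
    obtain C where "C \<in> \<C>" "x \<in> C" using C(2) by blast
    with C(1) clopen_neighbourhood[of C x]
    show "\<exists>D. open D \<and> closed D \<and> x \<in> D \<and> (\<exists>C\<in>\<C>. D \<subseteq> C)" by metis
  qed
  from choice[OF this] obtain D where D: "\<And>x. open (D x)" "\<And>x. closed (D x)" "\<And>x. x \<in> D x"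
    "\<And>x. \<exists>C\<in>\<C>. D x \<subseteq> C" by auto
  define u :: "nat \<Rightarrow> 'a" where "u = from_nat_into UNIV"
  define E where "E n = D (u n) - (\<Union>k<n. D (u k))" for n
  have cover: "\<exists>n. x \<in> E n" for x
  proof -
    obtain n0 where "u n0 = x" unfolding u_def using from_nat_into_surj[OF countable_space] by blast
    then have ex: "x \<in> D (u n0)" using D(3) by simp
    define n where "n = (LEAST n. x \<in> D (u n))"
    have "x \<in> D (u n)" unfolding n_def using ex by (rule LeastI)
    moreover have "x \<notin> D (u k)" if "k < n" for k using not_less_Least that unfolding n_def by blast
    ultimately have "x \<in> E n" by (auto simp: E_def)
    then show ?thesis by blast
  qed
  have lt: "E m \<inter> E n = {}" if "m < n" for m n using that by (auto simp: E_def)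
  have "finite {n. E n \<noteq> {}}"
  proof (rule finite_clopen_partition)
    show "open (E n)" for n
      unfolding E_def using D by (intro open_Diff closed_UN) auto
    show "(\<Union>n. E n) = UNIV" using cover by blast
    show "E m \<inter> E n = {}" if "m \<noteq> n" for m n
      using lt[of m n] lt[of n m] that by (cases "m < n") auto
  qed
  moreover obtain c where c: "\<And>x. c x \<in> \<C> \<and> D x \<subseteq> c x" using D(4) by metis
  moreover have "\<exists>n. E n \<noteq> {} \<and> x \<in> c (u n)" for x
  proof -
    obtain n where n: "x \<in> E n" using cover by blast
    then have "x \<in> c (u n)" using c[of "u n"] by (auto simp: E_def)
    with n show ?thesis by blast
  qed
  ultimately show "\<exists>\<C>'\<subseteq>\<C>. finite \<C>' \<and> UNIV \<subseteq> \<Union>\<C>'"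
    by (intro exI[of _ "(\<lambda>n. c (u n)) ` {n. E n \<noteq> {}}"]) auto
qed

end

section \<open>From the topological property to the norm setting\<close>

lemma closedin_dual_norm_le:
  assumes "\<phi> \<in> topological_dual bcont_scale T"
  shows "closedin T {f \<in> topspace T. norm (\<phi> f) \<le> r}"
proof -
  have "closedin T {f \<in> topspace T. \<phi> f \<in> cball 0 r}"
    using assms unfolding topological_dual_def
    by (intro closedin_continuous_map_preimage) auto
  then show ?thesis by simp
qed

text \<open>The bridge to a uniform bound: a barrel of an intermediate topology contains a norm
  ball, so pointwise boundedness of \<open>T\<close>-continuous functionals becomes norm
  boundedness.\<close>

lemma barrel_polar_pointwise_bounded:
  fixes T :: "('a::topological_space \<Rightarrow>\<^sub>C 'k::real_normed_field) topology"
  assumes top: "topspace T = UNIV" and dual: "\<And>n::nat. \<phi> n \<in> topological_dual bcont_scale T"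
    and bdd: "\<And>f. \<exists>K. \<forall>n. norm (\<phi> n f) \<le> K"
  shows "barrel bcont_scale T {f. \<forall>n. norm (\<phi> n f) \<le> 1}"
proof -
  let ?U = "{f. \<forall>n. norm (\<phi> n f) \<le> 1}"
  have lin: "\<phi> n (f + g) = \<phi> n f + \<phi> n g" "\<phi> n (bcont_scale c f) = c * \<phi> n f" for n f g c
    using dual[of n] by (simp_all add: topological_dual_def linear_bcont_scale_iff)
  have "closedin T (\<Inter>n. {f \<in> topspace T. norm (\<phi> n f) \<le> 1})"
    using closedin_dual_norm_le[OF dual] by (intro closedin_INT) auto
  also have "(\<Inter>n. {f \<in> topspace T. norm (\<phi> n f) \<le> 1}) = ?U" by (auto simp: top)
  finally have "closedin T ?U" .
  moreover have "absolutely_convex bcont_scale ?U"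
    unfolding absolutely_convex_def
  proof (intro ballI allI impI CollectI)
    fix f g and a b :: 'k and n
    assume fg: "f \<in> ?U" "g \<in> ?U" and ab: "norm a + norm b \<le> 1"
    have "norm (\<phi> n (bcont_scale a f + bcont_scale b g)) \<le> norm a * norm (\<phi> n f) + norm b * norm (\<phi> n g)"
      unfolding lin by (intro norm_triangle_le) (simp add: norm_mult)
    also have "\<dots> \<le> norm a * 1 + norm b * 1"
      using fg by (intro add_mono mult_left_mono) auto
    finally show "norm (\<phi> n (bcont_scale a f + bcont_scale b g)) \<le> 1" using ab by simp
  qed
  moreover have "absorbing bcont_scale ?U"
    unfolding absorbing_def
  proof
    fix f
    obtain K where K: "\<And>n. norm (\<phi> n f) \<le> K" using bdd by blast
    show "\<exists>r>0. \<forall>c. r \<le> norm c \<longrightarrow> f \<in> bcont_scale c ` ?U"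
    \<comment> \<open>The 1 excludes c = 0, which a bound \<open>K\<close> of 0 would allow.\<close>
    proof (intro exI[of _ "max 1 K"] conjI allI impI)
      fix c :: 'k assume c: "max 1 K \<le> norm c"
      then have "c \<noteq> 0" by auto
      have "norm (\<phi> n (bcont_scale (inverse c) f)) \<le> 1" for n
      proof -
        have "norm (\<phi> n (bcont_scale (inverse c) f)) = norm (\<phi> n f) / norm c"
          unfolding lin by (simp add: norm_mult norm_inverse divide_inverse mult.commute)
        also have "\<dots> \<le> 1"
          using K[of n] c \<open>c \<noteq> 0\<close> by (simp add: pos_divide_le_eq)
        finally show ?thesis .
      qed
      then have "bcont_scale (inverse c) f \<in> ?U" by blast
      then have "bcont_scale c (bcont_scale (inverse c) f) \<in> bcont_scale c ` ?U" by (rule imageI)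
      then show "f \<in> bcont_scale c ` ?U" unfolding bcont_scale_inverse[OF \<open>c \<noteq> 0\<close>] .
    qed simp
  qed
  ultimately show ?thesis by (simp add: barrel_def)
qed

proposition strongly_GP_imp_compact_countable_finite_height:
  fixes T :: "('a::topological_space \<Rightarrow>\<^sub>C 'k::{real_normed_field,euclidean_space}) topology"
  assumes tych: "Hausdorff_space (euclidean :: 'a topology)"
    "completely_regular_space (euclidean :: 'a topology)"
  and T: "T \<in> intermediate_lc_topologies" and GP: "strongly_Gelfand_Phillips bcont_scale T"
  shows "compact (UNIV :: 'a set) \<and> countable (UNIV :: 'a set) \<and> finite_scattered_height TYPE('a)"
proof -
  obtain \<phi> where null: "weak_star_null bcont_scale T \<phi>"
    and gp: "\<And>B. barrel_bounded bcont_scale T B \<Longrightarrow> \<not> barrel_precompact bcont_scale T B \<Longrightarrow>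
      \<not> (\<lambda>n. functional_norm_on B (\<phi> n)) \<longlonglongrightarrow> 0"
    using GP unfolding strongly_Gelfand_Phillips_def by (elim exE conjE) metis
  have dual: "\<phi> n \<in> topological_dual bcont_scale T" and lim: "(\<lambda>n. \<phi> n f) \<longlonglongrightarrow> 0" for n f
    using null by (simp_all add: weak_star_null_def)
  have lin: "\<phi> n (f + g) = \<phi> n f + \<phi> n g" "\<phi> n (bcont_scale c f) = c * \<phi> n f" for n f g c
    using dual[of n] by (simp_all add: topological_dual_def linear_bcont_scale_iff)
  have zero: "\<phi> n 0 = 0" for n
    using lin(1)[of n 0 0] by simp
  have "\<exists>K. \<forall>n. norm (\<phi> n f) \<le> K" for f
    using convergent_imp_Bseq[OF convergentI[OF lim[of f]]] unfolding Bseq_def by blast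
  then have bar: "barrel bcont_scale T {f. \<forall>n. norm (\<phi> n f) \<le> 1}"
    by (intro barrel_polar_pointwise_bounded intermediate_topspace[OF T] dual)
  obtain r where r: "r > 0" "cball 0 r \<subseteq> {f. \<forall>n. norm (\<phi> n f) \<le> 1}"
    by (rule barrel_contains_cball[OF T bar])
  have bound: "norm (\<phi> n f) \<le> 1 / r * norm f" for n f
  proof (cases "f = 0")
    case False
    \<comment> \<open>Moves \<open>f\<close> to norm \<open>r\<close>, where the polar gives the
      bound 1; homogeneity then yields the constant 1 / r.\<close>
    let ?c = "of_real (r / norm f) :: 'k"
    have "norm (bcont_scale ?c f) = r"
      unfolding bcont_scale_of_real using False r(1) by simp
    then have "bcont_scale ?c f \<in> cball 0 r" by simp
    then have "norm (\<phi> n (bcont_scale ?c f)) \<le> 1" using r(2) by blast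
    then have "r / norm f * norm (\<phi> n f) \<le> 1"
      using False r(1) by (simp add: lin norm_mult norm_divide)
    then show ?thesis using False r(1) by (simp add: field_simps)
  qed (simp add: zero)
  interpret Gelfand_Phillips_sequence \<phi> "1 / r"
  proof
    show "Hausdorff_space (euclidean :: 'a topology)" "completely_regular_space (euclidean :: 'a topology)"
      by (fact tych)+
    show "\<phi> n (f + g) = \<phi> n f + \<phi> n g" "\<phi> n (bcont_scale c f) = c * \<phi> n f" for n f g c
      by (fact lin)+
    show "norm (\<phi> n f) \<le> 1 / r * norm f" for n f by (rule bound)
    show "0 \<le> 1 / r" using r(1) by simp
    show "(\<lambda>n. \<phi> n f) \<longlonglongrightarrow> 0" for f by (rule lim)
    fix B and e :: real
    assume B: "bounded B" and small: "\<And>e. e > 0 \<Longrightarrow> \<forall>\<^sub>F n in sequentially. \<forall>f\<in>B. norm (\<phi> n f) \<le> e"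
      and e: "e > 0"
    have "(\<lambda>n. functional_norm_on B (\<phi> n)) \<longlonglongrightarrow> 0"
      unfolding functional_norm_on_tendsto_0_iff
    proof (intro allI impI)
      fix e :: real assume "e > 0"
      from small[OF this] show "\<forall>\<^sub>F n in sequentially. \<forall>f\<in>B \<union> {0}. norm (\<phi> n f) \<le> e"
        by eventually_elim (use \<open>e > 0\<close> zero in auto)
    qed
    moreover have "barrel_bounded bcont_scale T B" using B barrel_bounded_iff_bounded[OF T] by blast
    ultimately have "barrel_precompact bcont_scale T B" using gp by blast
    then show "\<exists>F. finite F \<and> B \<subseteq> (\<Union>f\<in>F. cball f e)"
      using e barrel_precompact_iff_totally_bounded[OF T] by blast
  qed
  show ?thesis
    using compact_space countable_space finite_height by (simp add: finite_scattered_height_def)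
qed

text \<open>The sort of the scalars covers \<open>real\<close> and \<open>complex\<close>, so both
  cases are instances of one equivalence.\<close>

proposition strongly_GP_intermediate_iff:
  assumes tych: "Hausdorff_space (euclidean :: 'a::topological_space topology)"
    "completely_regular_space (euclidean :: 'a topology)"
  defines "\<T> \<equiv> intermediate_lc_topologies :: ('a \<Rightarrow>\<^sub>C 'k::{real_normed_field,euclidean_space}) topology set"
  shows "((\<forall>T\<in>\<T>. strongly_Gelfand_Phillips bcont_scale T) \<longleftrightarrow>
      (\<exists>T\<in>\<T>. strongly_Gelfand_Phillips bcont_scale T)) \<and>
    ((\<exists>T\<in>\<T>. strongly_Gelfand_Phillips bcont_scale T) \<longleftrightarrow>
      compact (UNIV :: 'a set) \<and> countable (UNIV :: 'a set) \<and> finite_scattered_height TYPE('a))"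
proof -
  have 1: "compact (UNIV :: 'a set) \<and> countable (UNIV :: 'a set) \<and> finite_scattered_height TYPE('a)"
    if "\<exists>T\<in>\<T>. strongly_Gelfand_Phillips bcont_scale T"
    using that strongly_GP_imp_compact_countable_finite_height[OF tych] unfolding \<T>_def by metis
  have 2: "strongly_Gelfand_Phillips bcont_scale T"
    if "compact (UNIV :: 'a set) \<and> countable (UNIV :: 'a set) \<and> finite_scattered_height TYPE('a)" "T \<in> \<T>" for T
    using that compact_countable_finite_height_strongly_GP[OF tych] unfolding \<T>_def by metis
  have 3: "\<exists>T\<in>\<T>. strongly_Gelfand_Phillips bcont_scale T" if "\<forall>T\<in>\<T>. strongly_Gelfand_Phillips bcont_scale T"
    using that sup_norm_topology_intermediate unfolding \<T>_def by metis
  show ?thesis using 1 2 3 by metis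
qed

theorem theorem3p18:
  assumes tychonoff: "Hausdorff_space (euclidean :: 'a::topological_space topology)"
    "completely_regular_space (euclidean :: 'a topology)"
  shows
    "(infinite_dimensional (bcont_scale :: real \<Rightarrow> ('a \<Rightarrow>\<^sub>C real) \<Rightarrow> ('a \<Rightarrow>\<^sub>C real)) \<longrightarrow>
      ((\<forall>T \<in> (intermediate_lc_topologies :: ('a \<Rightarrow>\<^sub>C real) topology set).
          strongly_Gelfand_Phillips bcont_scale T) \<longleftrightarrow>
       (\<exists>T \<in> (intermediate_lc_topologies :: ('a \<Rightarrow>\<^sub>C real) topology set).
          strongly_Gelfand_Phillips bcont_scale T)) \<and>
      ((\<exists>T \<in> (intermediate_lc_topologies :: ('a \<Rightarrow>\<^sub>C real) topology set).
          strongly_Gelfand_Phillips bcont_scale T) \<longleftrightarrow>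
       compact (UNIV :: 'a set) \<and> countable (UNIV :: 'a set) \<and>
         finite_scattered_height TYPE('a))) \<and>
     (infinite_dimensional (bcont_scale :: complex \<Rightarrow> ('a \<Rightarrow>\<^sub>C complex) \<Rightarrow> ('a \<Rightarrow>\<^sub>C complex)) \<longrightarrow>
      ((\<forall>T \<in> (intermediate_lc_topologies :: ('a \<Rightarrow>\<^sub>C complex) topology set).
          strongly_Gelfand_Phillips bcont_scale T) \<longleftrightarrow>
       (\<exists>T \<in> (intermediate_lc_topologies :: ('a \<Rightarrow>\<^sub>C complex) topology set).
          strongly_Gelfand_Phillips bcont_scale T)) \<and>
      ((\<exists>T \<in> (intermediate_lc_topologies :: ('a \<Rightarrow>\<^sub>C complex) topology set).
          strongly_Gelfand_Phillips bcont_scale T) \<longleftrightarrow>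
       compact (UNIV :: 'a set) \<and> countable (UNIV :: 'a set) \<and>
         finite_scattered_height TYPE('a)))"
  using strongly_GP_intermediate_iff[OF tychonoff, where 'k=real]
    strongly_GP_intermediate_iff[OF tychonoff, where 'k=complex]
  by (intro conjI impI) metis+

end
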